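(* Let $n\ge2$ and let $\lambda$ be a partition with fewer than $n$ nonzero parts such that $|\lambda|$ is a multiple of $n$. Then $$\chi_{\Lambda_0}=\sum_{k\ge0}\ \sum_{F\in\mathcal C_k(\lambda)}\overline{x}^{\,F}\,q^{\frac{\lVert\lambda+k\theta\rVert^2}{2}-\mathrm{inv}(F)}.$$
   Context: $\theta=(2,1,1,\dots,1,0)$ is the partition with $n-1$ nonzero parts and $|\theta|=n$ (the highest root of $\mathfrak{sl}_n$). For $\gamma=(c_1,\dots,c_n)\in\mathbb R^n$, $|\gamma|=\sum c_i$ and $\lVert\gamma\rVert^2=\sum_{i=1}^nc_i^2-|\gamma|^2/n$. For $\gamma\in\mathbb Z^n$, $x^\gamma=\prod x_i^{\gamma_i}$. $$\chi_{\Lambda_0}:=\frac{\Theta(X_n,q)}{\prod_{k\ge1}(1-q^k)^{n-1}},\qquad\Theta(X_n,q)=\sum_{\gamma\in\mathbb Z^n,\,|\gamma|=0}q^{\lVert\gamma\rVert^2/2}x^\gamma;$$ this is the (normalized) character of the basic representation $L(\Lambda_0)$ of the affine Lie algebra $\widehat{\mathfrak{sl}_n}$. Identities are between formal power series in $q$ with Laurent polynomial coefficients in $x_1,\dots,x_n$. For a partition $\mu$ with at most $n$ parts, $\mathrm{dg}(\mu)=\{(r,c):1\le c\le\mu_r\}$ ($r$ = row from the top, $c$ = column from the left), and $\mathrm{CSF}(\mu)$ is the set of maps $F:\mathrm{dg}(\mu)\to[n]=\{1,\dots,n\}$ strictly increasing down each column. $x^F=\prod_{c\in\mathrm{dg}(\mu)}x_{F(c)}$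 and, for $n$ dividing $|\mu|$, $\overline{x}^{\,F}=x^F(x_1x_2\cdots x_n)^{-|\mu|/n}$. For a cell $u=(i,j)$ with $i>1$ let $u^\uparrow=(i-1,j)$; $\mathrm{Des}(F)$ is the set of cells $u$ not in the first row with $F(u)>F(u^\uparrow)$; $\mathrm{arm}(u)$ is the number of cells strictly to the right of $u$ in its row. A cell $u$ Inv-attacks $v$ if they are in the same row with $u$ strictly left of $v$, or $u$ is in the row immediately below that of $v$, in a column strictly to the right of that of $v$. $\mathrm{Inv}(F)$ is the set of pairs $(u,v)$ such that $u$ Inv-attacks $v$ and $F(u)>F(v)$; $\mathrm{inv}(F)=|\mathrm{Inv}(F)|-\sum_{u\in\mathrm{Des}(F)}\mathrm{arm}(u)$. $\mathcal C_0(\lambda)=\mathrm{CSF}(\lambda)$; for $k\ge1$, $\mathcal C_k(\lambda)$ is the set of $F\in\mathrm{CSF}(\lambda+k\theta)$ such that the entry $1$ either occurs in the first column of $F$ or does not occur in the last column of $F$. *)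

theory Defs
  imports "HOL-Analysis.Analysis" "HOL-Library.Poly_Mapping"
begin

section \<open>Laurent polynomials and vectors\<close>

text \<open>
  Laurent polynomials over the integers in the variables \<open>x\<^sub>i\<close>: finitely supported maps from
  exponent vectors to coefficients. A vector of \<open>\<int>\<^sup>n\<close> is an element of
  \<^typ>\<open>nat \<Rightarrow>\<^sub>0 int\<close> with support in \<open>{1..n}\<close>. Formal power series in \<open>q\<close> are of type
  \<open>lpoly fps\<close>, so \<^const>\<open>fps_X\<close> plays the role of \<open>q\<close>; infinite sums and products are taken in
  the library's topology on formal power series (every coefficient is eventually constant).
\<close>

type_synonym lpoly = "(nat \<Rightarrow>\<^sub>0 int) \<Rightarrow>\<^sub>0 int"

definition xmon :: "(nat \<Rightarrow>\<^sub>0 int) \<Rightarrow> lpoly" where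
  "xmon \<gamma> = Poly_Mapping.single \<gamma> 1"

definition xvar :: "nat \<Rightarrow> lpoly" where
  "xvar i = xmon (Poly_Mapping.single i 1)"

definition int_vecs :: "nat \<Rightarrow> (nat \<Rightarrow>\<^sub>0 int) set" where
  "int_vecs n = {\<gamma>. Poly_Mapping.keys \<gamma> \<subseteq> {1..n}}"

definition vsum :: "nat \<Rightarrow> (nat \<Rightarrow> 'a) \<Rightarrow> 'a :: comm_monoid_add" where
  "vsum n c = (\<Sum>i=1..n. c i)"

definition sqnorm :: "nat \<Rightarrow> (nat \<Rightarrow> real) \<Rightarrow> real" where
  "sqnorm n c = (\<Sum>i=1..n. (c i)\<^sup>2) - (vsum n c)\<^sup>2 / real n"

text \<open>Only meaningful for \<open>e \<in> \<nat>\<close>.\<close>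
definition qpow :: "real \<Rightarrow> lpoly fps" where
  "qpow e = fps_X ^ nat \<lfloor>e\<rfloor>"


section \<open>The character of the basic representation\<close>

definition Theta :: "nat \<Rightarrow> lpoly fps" where
  "Theta n = (\<Sum>\<^sub>\<infinity>\<gamma> | \<gamma> \<in> int_vecs n \<and> vsum n (Poly_Mapping.lookup \<gamma>) = 0.
     fps_const (xmon \<gamma>) * qpow (sqnorm n (\<lambda>i. real_of_int (Poly_Mapping.lookup \<gamma> i)) / 2))"

definition euler_prod :: "lpoly fps" where
  "euler_prod = prodinf (\<lambda>k. 1 - fps_X ^ Suc k)"

text \<open>
  The second argument of \<^const>\<open>fps_right_inverse\<close> is the inverse of the constant coefficient,
  which is \<open>1\<close> here; see \<open>chi_mult_euler_prod\<close> below.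
\<close>
definition chi_Lambda0 :: "nat \<Rightarrow> lpoly fps" where
  "chi_Lambda0 n = Theta n * fps_right_inverse (euler_prod ^ (n - 1)) 1"


section \<open>Partitions and column strict fillings\<close>

text \<open>
  The parts of \<open>\<mu>\<close> are \<open>\<mu> 1, \<mu> 2, \<dots>\<close>, followed by zeros; the value \<open>\<mu> 0\<close> is never used.
\<close>
definition is_partition :: "(nat \<Rightarrow> nat) \<Rightarrow> bool" where
  "is_partition \<mu> \<longleftrightarrow> (\<forall>i\<ge>1. \<mu> (Suc i) \<le> \<mu> i) \<and> finite {i. i \<ge> 1 \<and> \<mu> i \<noteq> 0}"

definition num_parts :: "(nat \<Rightarrow> nat) \<Rightarrow> nat" where
  "num_parts \<mu> = card {i. i \<ge> 1 \<and> \<mu> i \<noteq> 0}"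

definition hroot :: "nat \<Rightarrow> nat \<Rightarrow> nat" where
  "hroot n i = (if i = 1 then 2 else if 2 \<le> i \<and> i \<le> n - 1 then 1 else 0)"

definition add_hroot :: "nat \<Rightarrow> (nat \<Rightarrow> nat) \<Rightarrow> nat \<Rightarrow> nat \<Rightarrow> nat" where
  "add_hroot n \<mu> k = (\<lambda>i. \<mu> i + k * hroot n i)"

type_synonym cell = "nat \<times> nat"

definition dg :: "(nat \<Rightarrow> nat) \<Rightarrow> cell set" where
  "dg \<mu> = {(r, c). 1 \<le> r \<and> 1 \<le> c \<and> c \<le> \<mu> r}"

definition CSF :: "nat \<Rightarrow> (nat \<Rightarrow> nat) \<Rightarrow> (cell \<Rightarrow> nat) set" where
  "CSF n \<mu> = {F \<in> dg \<mu> \<rightarrow>\<^sub>E {1..n}.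
     \<forall>r r' c. (r, c) \<in> dg \<mu> \<and> (r', c) \<in> dg \<mu> \<and> r < r' \<longrightarrow> F (r, c) < F (r', c)}"

definition Des :: "(nat \<Rightarrow> nat) \<Rightarrow> (cell \<Rightarrow> nat) \<Rightarrow> cell set" where
  "Des \<mu> F = {(i, j) \<in> dg \<mu>. i > 1 \<and> F (i, j) > F (i - 1, j)}"

definition arm :: "(nat \<Rightarrow> nat) \<Rightarrow> cell \<Rightarrow> nat" where
  "arm \<mu> u = card {v \<in> dg \<mu>. fst v = fst u \<and> snd v > snd u}"

definition Inv_attacks :: "cell \<Rightarrow> cell \<Rightarrow> bool" where
  "Inv_attacks u v \<longleftrightarrow>
     fst u = fst v \<and> snd u < snd v \<or> fst u = Suc (fst v) \<and> snd u > snd v"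

definition Inv :: "(nat \<Rightarrow> nat) \<Rightarrow> (cell \<Rightarrow> nat) \<Rightarrow> (cell \<times> cell) set" where
  "Inv \<mu> F = {(u, v). u \<in> dg \<mu> \<and> v \<in> dg \<mu> \<and> Inv_attacks u v \<and> F u > F v}"

definition inv_stat :: "(nat \<Rightarrow> nat) \<Rightarrow> (cell \<Rightarrow> nat) \<Rightarrow> int" where
  "inv_stat \<mu> F = int (card (Inv \<mu> F)) - (\<Sum>u\<in>Des \<mu> F. int (arm \<mu> u))"

text \<open>\<open>x\<^sup>F (x\<^sub>1 \<cdots> x\<^sub>n)\<close> to the power \<open>- |\<mu>| / n\<close>, for \<open>n\<close> dividing \<open>|\<mu>|\<close>.\<close>
definition xbar :: "nat \<Rightarrow> (nat \<Rightarrow> nat) \<Rightarrow> (cell \<Rightarrow> nat) \<Rightarrow> lpoly" where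
  "xbar n \<mu> F = (\<Prod>u\<in>dg \<mu>. xvar (F u)) *
     xmon (\<Sum>i=1..n. Poly_Mapping.single i (- int (vsum n \<mu> div n)))"

text \<open>The first row is the longest one, so the last column is the one with index \<open>\<mu> 1\<close>.\<close>
definition occurs_in_column :: "(nat \<Rightarrow> nat) \<Rightarrow> (cell \<Rightarrow> nat) \<Rightarrow> nat \<Rightarrow> nat \<Rightarrow> bool" where
  "occurs_in_column \<mu> F a c \<longleftrightarrow> (\<exists>r. (r, c) \<in> dg \<mu> \<and> F (r, c) = a)"

definition C_set :: "nat \<Rightarrow> (nat \<Rightarrow> nat) \<Rightarrow> nat \<Rightarrow> (cell \<Rightarrow> nat) set" where
  "C_set n lam k = (if k = 0 then CSF n lam
     else {F \<in> CSF n (add_hroot n lam k).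
             occurs_in_column (add_hroot n lam k) F 1 1 \<or>
             \<not> occurs_in_column (add_hroot n lam k) F 1 (add_hroot n lam k 1)})"

definition q_expo :: "nat \<Rightarrow> (nat \<Rightarrow> nat) \<Rightarrow> (cell \<Rightarrow> nat) \<Rightarrow> real" where
  "q_expo n \<mu> F = sqnorm n (\<lambda>i. real (\<mu> i)) / 2 - real_of_int (inv_stat \<mu> F)"


section \<open>Well-definedness of the sums, products and quotients above\<close>

lemma half_sqnorm_Nats:
  fixes c :: "nat \<Rightarrow> int"
  assumes "vsum n c = 0"
  shows "sqnorm n (\<lambda>i. real_of_int (c i)) / 2 \<in> \<nat>"
proof -
  have "even (\<Sum>i=1..n. (c i)\<^sup>2 + c i)"
    by (rule dvd_sum) (simp add: power2_eq_square)
  hence "even (\<Sum>i=1..n. (c i)\<^sup>2)"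
    using assms by (simp add: sum.distrib vsum_def)
  then obtain m where m: "(\<Sum>i=1..n. (c i)\<^sup>2) = 2 * m" by blast
  have "0 \<le> (\<Sum>i=1..n. (c i)\<^sup>2)" by (simp add: sum_nonneg)
  hence "0 \<le> m" using m by simp
  have v: "vsum n (\<lambda>i. real_of_int (c i)) = 0"
    using assms unfolding vsum_def by (metis of_int_0 of_int_sum)
  have "sqnorm n (\<lambda>i. real_of_int (c i)) = real_of_int (\<Sum>i=1..n. (c i)\<^sup>2)"
    by (simp add: sqnorm_def v)
  also have "\<dots> = real_of_int (2 * m)" by (simp only: m)
  finally have "sqnorm n (\<lambda>i. real_of_int (c i)) / 2 = real (nat m)"
    using \<open>0 \<le> m\<close> by simp
  thus ?thesis by simp
qed

lemma finite_bounded_int_vecs: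
  "finite {\<gamma> \<in> int_vecs n. \<forall>i. \<bar>Poly_Mapping.lookup \<gamma> i\<bar> \<le> B}" (is "finite ?S")
proof -
  have inj: "inj_on Poly_Mapping.lookup ?S"
    by (intro inj_onI poly_mapping_eqI) simp
  have "Poly_Mapping.lookup ` ?S \<subseteq>
      {f. \<forall>x. (x \<in> {1..n} \<longrightarrow> f x \<in> {-B..B}) \<and> (x \<notin> {1..n} \<longrightarrow> f x = 0)}"
  proof safe
    fix \<gamma> :: "nat \<Rightarrow>\<^sub>0 int" and x
    assume \<gamma>: "\<gamma> \<in> int_vecs n" "\<forall>i. \<bar>Poly_Mapping.lookup \<gamma> i\<bar> \<le> B"
    show "Poly_Mapping.lookup \<gamma> x \<in> {-B..B}"
      using \<gamma>(2)[rule_format, of x] by (simp only: atLeastAtMost_iff) linarith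
    assume "x \<notin> {1..n}"
    thus "Poly_Mapping.lookup \<gamma> x = 0"
      using \<gamma>(1) unfolding int_vecs_def in_keys_iff subset_iff mem_Collect_eq by metis
  qed
  moreover have "finite {f. \<forall>x. (x \<in> {1..n} \<longrightarrow> f x \<in> {-B..B}) \<and> (x \<notin> {1..n} \<longrightarrow> f x = 0)}"
    by (rule finite_set_of_finite_funs) auto
  ultimately have "finite (Poly_Mapping.lookup ` ?S)" by (rule finite_subset)
  thus ?thesis using inj by (rule finite_imageD)
qed

lemma Theta_summable:
  "(\<lambda>\<gamma>. fps_const (xmon \<gamma>) * qpow (sqnorm n (\<lambda>i. real_of_int (Poly_Mapping.lookup \<gamma> i)) / 2))
     summable_on {\<gamma>. \<gamma> \<in> int_vecs n \<and> vsum n (Poly_Mapping.lookup \<gamma>) = 0}"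
  (is "?f summable_on ?A")
proof -
  have fin: "finite {\<gamma> \<in> ?A. fps_nth (?f \<gamma>) d \<noteq> 0}" for d
  proof (rule finite_subset[OF _ finite_bounded_int_vecs[of n "2 * int d"]], safe)
    fix \<gamma> i
    assume \<gamma>: "\<gamma> \<in> int_vecs n" "vsum n (Poly_Mapping.lookup \<gamma>) = 0"
      and nz: "fps_nth (?f \<gamma>) d \<noteq> 0"
    let ?c = "Poly_Mapping.lookup \<gamma>"
    from half_sqnorm_Nats[OF \<gamma>(2)] obtain m :: nat
      where m: "sqnorm n (\<lambda>i. real_of_int (?c i)) / 2 = real m" by (auto elim: Nats_cases)
    have "d = m"
      using nz by (simp add: qpow_def m fps_X_power_nth split: if_splits)
    moreover have "vsum n (\<lambda>i. real_of_int (?c i)) = 0"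
      using \<gamma>(2) unfolding vsum_def by (metis of_int_0 of_int_sum)
    ultimately have "real_of_int (\<Sum>j=1..n. (?c j)\<^sup>2) = real_of_int (2 * int d)"
      using m by (simp add: sqnorm_def)
    hence sum: "(\<Sum>j=1..n. (?c j)\<^sup>2) = 2 * int d" by (simp only: of_int_eq_iff)
    show "\<bar>?c i\<bar> \<le> 2 * int d"
    proof (cases "i \<in> {1..n}")
      case True
      have "(?c i)\<^sup>2 \<le> (\<Sum>j=1..n. (?c j)\<^sup>2)"
        using True by (intro member_le_sum) auto
      moreover have "\<bar>?c i\<bar> \<le> (?c i)\<^sup>2"
      proof (cases "?c i = 0")
        case False
        hence "\<bar>?c i\<bar> \<le> \<bar>?c i\<bar> ^ 2" by (intro self_le_power) auto
        thus ?thesis by simp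
      qed simp
      ultimately show ?thesis using sum by simp
    next
      case False
      hence "?c i = 0" using \<gamma>(1) by (auto simp: int_vecs_def in_keys_iff subset_iff)
      thus ?thesis by simp
    qed
  qed
  have "(?f has_sum Abs_fps (\<lambda>d. \<Sum>\<gamma> | \<gamma> \<in> ?A \<and> fps_nth (?f \<gamma>) d \<noteq> 0. fps_nth (?f \<gamma>) d)) ?A"
    by (rule has_sum_fpsI[OF fin]) simp
  thus ?thesis by (auto simp: summable_on_def)
qed

lemma euler_prod_LIMSEQ:
  "(\<lambda>N. \<Prod>k\<le>N. 1 - fps_X ^ Suc k :: lpoly fps) \<longlonglongrightarrow> euler_prod"
  and euler_prod_nth_0: "fps_nth euler_prod 0 = 1"
proof -
  let ?P = "\<lambda>N. \<Prod>k\<le>N. 1 - fps_X ^ Suc k :: lpoly fps"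
  define E where "E = Abs_fps (\<lambda>m. fps_nth (?P m) m)"
  have step: "fps_nth (?P (Suc N)) m = fps_nth (?P N) m" if "m \<le> N" for m N
    using that by (simp add: right_diff_distrib fps_X_power_mult_right_nth del: power_Suc)
  have "fps_nth (?P N) m = fps_nth E m" if "m \<le> N" for m N
    using that by (induction N rule: dec_induct) (simp_all only: step E_def fps_nth_Abs_fps)
  hence lim: "?P \<longlonglongrightarrow> E"
    by (intro tendsto_fpsI) (auto simp: eventually_sequentially)
  have E0: "fps_nth E 0 = 1"
    by (simp add: E_def)
  hence "E \<noteq> 0" by (metis fps_zero_nth zero_neq_one)
  with lim have 1: "(\<lambda>k. 1 - fps_X ^ Suc k :: lpoly fps) has_prod E"
    by (simp add: has_prod_def raw_has_prod_def)
  have nz: "(1 - fps_X ^ Suc k :: lpoly fps) \<noteq> 0" for k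
  proof
    assume "(1 - fps_X ^ Suc k :: lpoly fps) = 0"
    hence "fps_nth (1 - fps_X ^ Suc k :: lpoly fps) 0 = 0" by (simp only: fps_zero_nth)
    thus False by simp
  qed
  have "p = E" if "(\<lambda>k. 1 - fps_X ^ Suc k :: lpoly fps) has_prod p" for p
  proof -
    have "?P \<longlonglongrightarrow> p"
      using that nz unfolding has_prod_def raw_has_prod_def add_0_right by blast
    thus ?thesis using lim by (rule LIMSEQ_unique)
  qed
  with 1 have "euler_prod = E"
    unfolding euler_prod_def prodinf_def by (rule the_equality)
  with lim E0 show "?P \<longlonglongrightarrow> euler_prod" "fps_nth euler_prod 0 = 1" by simp_all
qed

lemma chi_mult_euler_prod: "chi_Lambda0 n * euler_prod ^ (n - 1) = Theta n"
proof -
  have "euler_prod ^ (n - 1) * fps_right_inverse (euler_prod ^ (n - 1)) 1 = 1"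
    by (rule fps_right_inverse) (simp add: fps_nth_power_0 euler_prod_nth_0)
  thus ?thesis by (simp only: chi_Lambda0_def mult.assoc mult.right_neutral
      mult.commute[of "fps_right_inverse _ _"])
qed

lemma finite_dg:
  assumes "is_partition lam"
  shows "finite (dg lam)" "finite (dg (add_hroot n lam k))"
proof -
  have *: "finite (dg \<mu>)" if "finite {i. i \<ge> 1 \<and> \<mu> i \<noteq> 0}" for \<mu>
  proof (rule finite_subset)
    show "dg \<mu> \<subseteq> (SIGMA r:{i. i \<ge> 1 \<and> \<mu> i \<noteq> 0}. {1..\<mu> r})"
      by (auto simp: dg_def)
    show "finite (SIGMA r:{i. i \<ge> 1 \<and> \<mu> i \<noteq> 0}. {1..\<mu> r})"
      using that by (intro finite_SigmaI) auto
  qed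
  have fin: "finite {i. i \<ge> 1 \<and> lam i \<noteq> 0}"
    using assms by (simp add: is_partition_def)
  thus "finite (dg lam)" by (rule *)
  have "{i. i \<ge> 1 \<and> add_hroot n lam k i \<noteq> 0} \<subseteq> {i. i \<ge> 1 \<and> lam i \<noteq> 0} \<union> {..max 1 n}"
    by (auto simp: add_hroot_def hroot_def split: if_splits)
  hence "finite {i. i \<ge> 1 \<and> add_hroot n lam k i \<noteq> 0}"
    by (rule finite_subset) (simp add: fin[simplified])
  thus "finite (dg (add_hroot n lam k))" by (rule *)
qed

lemma finite_C_set:
  assumes "is_partition lam"
  shows "finite (C_set n lam k)"
proof -
  have "finite (CSF n \<mu>)" if "finite (dg \<mu>)" for \<mu>
    using finite_PiE[OF that, of "\<lambda>_. {1..n}"] by (simp add: CSF_def)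
  thus ?thesis
    using finite_dg[OF assms] by (simp add: C_set_def)
qed

end

theory Submission
  imports Defs
begin

text \<open>
  Read a filling as the list of its column sets \<open>A\<^sub>1, A\<^sub>2, \<dots>\<close>, with content \<open>\<gamma>\<close>. Comparing
  \<open>\<Sum> \<mu>\<^sub>r\<^sup>2\<close> and \<open>\<Sum> \<gamma>\<^sub>i\<^sup>2\<close> column by column, the exponent of \<open>q\<close> becomes
  \<open>\<parallel>\<gamma>\<parallel>\<^sup>2 / 2\<close> plus the sum over \<open>c < d\<close> of the number of \<open>b \<in> A\<^sub>d - A\<^sub>c\<close> that have different
  ranks in \<open>A\<^sub>c\<close> and in \<open>A\<^sub>d\<close>. Putting a column \<open>{2..n}\<close> in front and a column \<open>{1}\<close> at the end
  changes neither \<open>\<gamma>\<close>, up to the normalisation, nor this number, so the sum over \<open>k \<le> K\<close>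
  telescopes to the sum over all fillings of shape \<open>\<lambda> + K\<theta>\<close>.

  It remains to see that the fillings of fixed normalised content \<open>\<gamma>\<close> contribute
  \<open>\<Prod>\<^sub>k (1 - q\<^sup>k)\<close> to the power \<open>-(n - 1)\<close> in the limit. Removing the letter \<open>n\<close> from the columns
  in a set \<open>S\<close> costs the number of pairs \<open>i < j\<close> with \<open>i \<notin> S\<close>, \<open>j \<in> S\<close>; up to order the remaining
  columns form a shape for \<open>n - 1\<close> letters, and adjacent columns whose heights differ by one may be
  exchanged. If the content lies deep inside the permutohedron of the shape, this persists for
  every \<open>S\<close> of small cost, so by induction the generating function is a Gaussian binomial
  coefficient with large parameters, which is close to \<open>\<Prod>\<^sub>k (1 - q\<^sup>k)\<^sup>-\<^sup>1\<close>, times the one for \<open>n - 1\<close>.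
\<close>

section \<open>Column statistics and removal of the largest letter\<close>

text \<open>\<open>card (A \<inter> {..<b})\<close> is the rank that \<open>b\<close> has, or would
  have, in \<open>A\<close>. When \<open>A\<close> is the taller column, a letter of
  \<open>B - A\<close> has equal ranks, and so is free, exactly when it interlaces with
  \<open>A\<close>.\<close>

definition dcol :: "nat set \<Rightarrow> nat set \<Rightarrow> nat" where
  "dcol A B = card {b \<in> B - A. card (A \<inter> {..<b}) \<noteq> card (B \<inter> {..<b})}"

fun pair_sum :: "('a \<Rightarrow> 'a \<Rightarrow> nat) \<Rightarrow> 'a list \<Rightarrow> nat" where
  "pair_sum w [] = 0"
| "pair_sum w (x # xs) = (\<Sum>y\<leftarrow>xs. w x y) + pair_sum w xs"

lemma pair_sum_append:
  "pair_sum w (xs @ ys) = pair_sum w xs + (\<Sum>x\<leftarrow>xs. \<Sum>y\<leftarrow>ys. w x y) + pair_sum w ys"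
  by (induction xs) (simp_all add: sum_list_addf)

lemma pair_sum_swap:
  "pair_sum w (xs @ x # y # ys) + w y x = pair_sum w (xs @ y # x # ys) + w x y"
  by (simp add: pair_sum_append ac_simps)

lemma pair_sum_add:
  "pair_sum (\<lambda>x y. v x y + w x y) xs = pair_sum v xs + pair_sum w xs"
  by (induction xs) (simp_all add: sum_list_addf)

lemma pair_sum_map: "pair_sum w (map f xs) = pair_sum (\<lambda>x y. w (f x) (f y)) xs"
  by (induction xs) (simp_all add: o_def)

lemma pair_sum_cong:
  assumes "\<And>x y. x \<in> set xs \<Longrightarrow> y \<in> set xs \<Longrightarrow> v x y = w x y"
  shows "pair_sum v xs = pair_sum w xs"
  using assms by (induction xs) (auto intro!: arg_cong[where f = sum_list] map_cong)

definition fillings :: "nat \<Rightarrow> nat list \<Rightarrow> nat set list set" where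
  "fillings n \<eta> = {Cs. map card Cs = \<eta> \<and> (\<forall>A\<in>set Cs. A \<subseteq> {1..n})}"

definition occ :: "nat \<Rightarrow> nat set list \<Rightarrow> nat" where
  "occ i Cs = length (filter (\<lambda>A. i \<in> A) Cs)"

text \<open>Only the values of \<open>g\<close> on \<open>{1..n}\<close> enter, so the same
  \<open>g\<close> still serves after the largest letter has been removed.\<close>

definition with_content :: "nat \<Rightarrow> nat list \<Rightarrow> (nat \<Rightarrow> nat) \<Rightarrow> nat set list set" where
  "with_content n \<eta> g = {Cs \<in> fillings n \<eta>. \<forall>i\<in>{1..n}. occ i Cs = g i}"

definition Dgen :: "nat \<Rightarrow> nat list \<Rightarrow> (nat \<Rightarrow> nat) \<Rightarrow> 'a :: comm_ring_1 fps" where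
  "Dgen n \<eta> g = (\<Sum>Cs\<in>with_content n \<eta> g. fps_X ^ pair_sum dcol Cs)"

lemma finite_fillings: "finite (fillings n \<eta>)"
proof (rule finite_subset)
  show "fillings n \<eta> \<subseteq> {Cs. set Cs \<subseteq> Pow {1..n} \<and> length Cs = length \<eta>}"
    by (auto simp: fillings_def)
qed (simp add: finite_lists_length_eq)

lemma finite_with_content: "finite (with_content n \<eta> g)"
  by (simp add: with_content_def finite_fillings)

text \<open>A pair records the height of a column and whether the column contains the largest
  letter; an empty column cannot.\<close>

definition marks :: "nat list \<Rightarrow> nat \<Rightarrow> (nat \<times> bool) list set" where
  "marks \<eta> c = {zs. map fst zs = \<eta> \<and> length (filter snd zs) = c \<and> (\<forall>z\<in>set zs. snd z \<longrightarrow> 0 < fst z)}"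

definition lower :: "nat \<times> bool \<Rightarrow> nat" where
  "lower z = fst z - of_bool (snd z)"

definition mark_stat :: "nat \<times> bool \<Rightarrow> nat \<times> bool \<Rightarrow> nat" where
  "mark_stat z z' = of_bool (\<not> snd z \<and> snd z' \<and> Suc (fst z) \<noteq> fst z')"

lemma finite_marks: "finite (marks \<eta> c)"
proof (rule finite_subset)
  show "marks \<eta> c \<subseteq> {zs. set zs \<subseteq> set \<eta> \<times> UNIV \<and> length zs = length \<eta>}"
    by (auto simp: marks_def) (use image_iff in fastforce)
qed (simp add: finite_lists_length_eq)

text \<open>The ranks of smaller letters do not see the letter \<open>Suc n\<close>. If this letter
  lies in \<open>B\<close> but not in \<open>A\<close>, its ranks are \<open>card A\<close> and
  \<open>card B - 1\<close>; this is the origin of the exception in \<open>mark_stat\<close> for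
  heights that differ by one.\<close>

lemma dcol_remove_top:
  assumes "A \<subseteq> {1..Suc n}" "B \<subseteq> {1..Suc n}"
  shows "dcol A B = mark_stat (card A, Suc n \<in> A) (card B, Suc n \<in> B) +
           dcol (A - {Suc n}) (B - {Suc n})"
proof -
  let ?t = "Suc n"
  have fin: "finite A" "finite B" using assms finite_subset by blast+
  have lt: "(C - {?t}) \<inter> {..<b} = C \<inter> {..<b}" if "b \<le> ?t" for C :: "nat set" and b
    using that by auto
  have top: "C \<inter> {..<?t} = C - {?t}" if "C \<subseteq> {1..?t}" for C
    using that by (auto simp: less_Suc_eq_le le_Suc_eq)
  let ?P = "\<lambda>b. card (A \<inter> {..<b}) \<noteq> card (B \<inter> {..<b})"
  have "{b \<in> B - A. ?P b} = {b \<in> (B - {?t}) - (A - {?t}). ?P b} \<union> {b \<in> (B - A) \<inter> {?t}. ?P b}"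
    by auto
  hence "card {b \<in> B - A. ?P b} =
      card {b \<in> (B - {?t}) - (A - {?t}). ?P b} + card {b \<in> (B - A) \<inter> {?t}. ?P b}"
    by (simp only:) (subst card_Un_disjoint; use fin in auto)
  moreover have "{b \<in> (B - {?t}) - (A - {?t}). ?P b} = {b \<in> (B - {?t}) - (A - {?t}).
      card ((A - {?t}) \<inter> {..<b}) \<noteq> card ((B - {?t}) \<inter> {..<b})}"
    using assms lt by (intro Collect_cong conj_cong refl) (auto dest: subsetD)
  moreover have "card {b \<in> (B - A) \<inter> {?t}. ?P b} = mark_stat (card A, ?t \<in> A) (card B, ?t \<in> B)"
  proof (cases "?t \<in> B - A")
    case True
    have "card B = Suc (card (B - {?t}))" using True fin by (metis DiffD1 card.remove)
    moreover have "A - {?t} = A" using True by auto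
    ultimately have "?P ?t \<longleftrightarrow> Suc (card A) \<noteq> card B"
      using top assms by auto
    moreover have "card {b \<in> (B - A) \<inter> {?t}. ?P b} = of_bool (?P ?t)"
    proof -
      have "{b \<in> (B - A) \<inter> {?t}. ?P b} = (if ?P ?t then {?t} else {})" using True by auto
      thus ?thesis by simp
    qed
    ultimately show ?thesis using True by (simp only:) (simp add: mark_stat_def)
  qed (auto simp: mark_stat_def)
  ultimately show ?thesis by (simp add: dcol_def)
qed

definition split_top :: "nat \<Rightarrow> nat set list \<Rightarrow> (nat \<times> bool) list \<times> nat set list" where
  "split_top n Cs = (map (\<lambda>A. (card A, Suc n \<in> A)) Cs, map (\<lambda>A. A - {Suc n}) Cs)"

definition join_top :: "nat \<Rightarrow> (nat \<times> bool) list \<times> nat set list \<Rightarrow> nat set list" where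
  "join_top n p = map (\<lambda>(z, A). if snd z then insert (Suc n) A else A) (zip (fst p) (snd p))"

lemma occ_Cons [simp]: "occ i (A # Cs) = of_bool (i \<in> A) + occ i Cs"
  and occ_Nil [simp]: "occ i [] = 0"
  by (simp_all add: occ_def)

text \<open>A filling amounts to a marking together with a filling of the lowered columns by
  \<open>n\<close> letters, and \<open>dcol_remove_top\<close> makes the statistic additive. The
  heights may come in any order, as lowering some of the columns can destroy monotonicity.\<close>

lemma Dgen_Suc:
  "Dgen (Suc n) \<eta> g =
     (\<Sum>zs\<in>marks \<eta> (g (Suc n)). fps_X ^ pair_sum mark_stat zs * Dgen n (map lower zs) g)"
proof -
  let ?M = "SIGMA zs:marks \<eta> (g (Suc n)). with_content n (map lower zs) g"
  have sub: "A \<subseteq> {1..n} \<Longrightarrow> Suc n \<notin> A" "A \<subseteq> {1..n} \<Longrightarrow> finite A" for A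
    by (auto intro: finite_subset)
  have "Dgen (Suc n) \<eta> g =
      (\<Sum>(zs, Cs)\<in>?M. fps_X ^ (pair_sum mark_stat zs + pair_sum dcol Cs) :: 'a fps)"
    unfolding Dgen_def
  proof (rule sum.reindex_bij_witness[of _ "join_top n" "split_top n"])
    fix Cs assume Cs: "Cs \<in> with_content (Suc n) \<eta> g"
    hence sub': "\<forall>A\<in>set Cs. A \<subseteq> {1..Suc n}" by (simp add: with_content_def fillings_def)
    hence fin: "\<forall>A\<in>set Cs. finite A" by (auto intro: finite_subset)
    show "join_top n (split_top n Cs) = Cs"
      unfolding join_top_def split_top_def
      by (induction Cs) (auto simp: insert_absorb)
    have "lower (card A, Suc n \<in> A) = card (A - {Suc n})" if "A \<in> set Cs" for A
      using fin that by (auto simp: lower_def card_Diff_singleton)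
    hence low: "map card (map (\<lambda>A. A - {Suc n}) Cs) = map lower (map (\<lambda>A. (card A, Suc n \<in> A)) Cs)"
      by simp
    have o1: "occ i (map (\<lambda>A. A - {Suc n}) Cs) = occ i Cs" if "i \<in> {1..n}" for i
      using that by (induction Cs) auto
    have o2: "occ (Suc n) Cs = length (filter snd (map (\<lambda>A. (card A, Suc n \<in> A)) Cs))"
      by (simp add: occ_def filter_map o_def)
    have "0 < card A" if "A \<in> set Cs" "Suc n \<in> A" for A
      using that fin by (auto simp: card_gt_0_iff)
    moreover have "map (\<lambda>A. A - {Suc n}) Cs \<in> fillings n (map lower (map (\<lambda>A. (card A, Suc n \<in> A)) Cs))"
      using sub' low by (fastforce simp: fillings_def le_Suc_eq)
    ultimately show "split_top n Cs \<in> ?M"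
      using Cs o1 o2 by (auto simp: split_top_def marks_def with_content_def fillings_def o_def)
    have "pair_sum dcol Cs = pair_sum (\<lambda>A B. mark_stat (card A, Suc n \<in> A) (card B, Suc n \<in> B) +
           dcol (A - {Suc n}) (B - {Suc n})) Cs"
      using sub' by (intro pair_sum_cong dcol_remove_top) auto
    thus "(case split_top n Cs of (zs, Cs) \<Rightarrow> fps_X ^ (pair_sum mark_stat zs + pair_sum dcol Cs)) =
        (fps_X ^ pair_sum dcol Cs :: 'a fps)"
      by (simp add: split_top_def pair_sum_map pair_sum_add)
  next
    fix p assume "p \<in> ?M"
    then obtain zs Cs where p: "p = (zs, Cs)" and zs: "zs \<in> marks \<eta> (g (Suc n))"
      and Cs: "Cs \<in> with_content n (map lower zs) g" by blast
    have low: "map card Cs = map lower zs" and subs: "\<forall>A\<in>set Cs. A \<subseteq> {1..n}"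
      and pos: "\<forall>z\<in>set zs. snd z \<longrightarrow> 0 < fst z" and fst: "map fst zs = \<eta>"
      using zs Cs by (auto simp: with_content_def fillings_def marks_def)
    have all2: "list_all2 (\<lambda>z A. A \<subseteq> {1..n} \<and> card A = lower z \<and> (snd z \<longrightarrow> 0 < fst z)) zs Cs"
      using low subs pos by (induction zs Cs rule: list_induct2')  auto
    have "split_top n (join_top n (zs, Cs)) = (zs, Cs)"
      using all2 unfolding split_top_def join_top_def
      by (induction rule: list_all2_induct) (auto simp: lower_def sub prod_eq_iff)
    thus "split_top n (join_top n p) = p" by (simp add: p)
    have "map card (join_top n (zs, Cs)) = map fst zs \<and> (\<forall>A\<in>set (join_top n (zs, Cs)). A \<subseteq> {1..Suc n})"
      using all2 unfolding join_top_def
      by (induction rule: list_all2_induct) (auto simp: lower_def sub)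
    moreover have "occ i (join_top n (zs, Cs)) = (if i = Suc n then length (filter snd zs) else occ i Cs)" for i
      using all2 unfolding join_top_def
      by (induction rule: list_all2_induct) (auto simp: sub)
    ultimately show "join_top n p \<in> with_content (Suc n) \<eta> g"
      using zs Cs by (auto simp: p with_content_def fillings_def marks_def)
  qed
  also have "\<dots> = (\<Sum>zs\<in>marks \<eta> (g (Suc n)). \<Sum>Cs\<in>with_content n (map lower zs) g.
      fps_X ^ pair_sum mark_stat zs * fps_X ^ pair_sum dcol Cs)"
    by (subst sum.Sigma) (auto simp: finite_marks finite_with_content power_add)
  finally show ?thesis by (simp add: Dgen_def sum_distrib_left)
qed

section \<open>Exchanging adjacent columns\<close>

lemma with_content_0: "with_content 0 \<eta> g = {Cs. Cs = map (\<lambda>_. {}) \<eta> \<and> (\<forall>h\<in>set \<eta>. h = 0)}"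
proof -
  have "map card Cs = \<eta> \<and> (\<forall>A\<in>set Cs. A = {}) \<longleftrightarrow> Cs = map (\<lambda>_. {}) \<eta> \<and> (\<forall>h\<in>set \<eta>. h = 0)"
    for Cs :: "nat set list"
    by (induction Cs \<eta> rule: list_induct2') (auto simp: Cons_eq_map_conv)
  thus ?thesis by (auto simp: with_content_def fillings_def)
qed

lemma Dgen_0: "Dgen 0 \<eta> g = of_bool (\<forall>h\<in>set \<eta>. h = 0)"
proof -
  have [simp]: "pair_sum dcol (map (\<lambda>_. {}) \<eta>) = 0"
    by (induction \<eta>) (auto simp: dcol_def)
  show ?thesis
  proof (cases "\<forall>h\<in>set \<eta>. h = 0")
    case True
    hence "with_content 0 \<eta> g = {map (\<lambda>_. {}) \<eta>}" by (auto simp: with_content_0)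
    thus ?thesis using True by (simp add: Dgen_def)
  next
    case False
    hence "with_content 0 \<eta> g = {}" by (simp only: with_content_0) blast
    thus ?thesis using False by (simp add: Dgen_def)
  qed
qed

text \<open>Isolates the marks of two adjacent columns, so that the sums for both orders of the two
  heights correspond by exchanging \<open>d\<close> and \<open>e\<close>.\<close>

lemma sum_marks_append2:
  "(\<Sum>zs\<in>marks (xs @ a # b # ys) c. f zs) =
   (\<Sum>(us, d, e, vs) | map fst us = xs \<and> map fst vs = ys \<and>
        us @ (a, d) # (b, e) # vs \<in> marks (xs @ a # b # ys) c. f (us @ (a, d) # (b, e) # vs))"
proof (rule sum.reindex_bij_witness[symmetric, where
    i = "\<lambda>zs. (take (length xs) zs, snd (zs ! length xs), snd (zs ! Suc (length xs)), drop (length xs + 2) zs)" and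
    j = "\<lambda>(us, d, e, vs). us @ (a, d) # (b, e) # vs"], goal_cases)
  case (1 p)
  thus ?case by (auto simp: nth_append)
next
  case (2 p)
  thus ?case by auto
next
  case (3 zs)
  then obtain us d e vs where "zs = us @ (a, d) # (b, e) # vs" "map fst us = xs" "map fst vs = ys"
    by (auto simp: marks_def map_eq_append_conv Cons_eq_map_conv map_eq_Cons_conv)
  thus ?case by (auto simp: nth_append)
next
  case (4 zs)
  then obtain us d e vs where "zs = us @ (a, d) # (b, e) # vs" "map fst us = xs" "map fst vs = ys"
    by (auto simp: marks_def map_eq_append_conv Cons_eq_map_conv map_eq_Cons_conv)
  thus ?case using 4 by (auto simp: nth_append)
qed auto

text \<open>
  Induction on the number of letters: apart from the case where exactly the right one of two columns
  of heights \<open>a\<close> and \<open>a + 1\<close> carries the largest letter, removing it keeps the two heights in order.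
\<close>
lemma Dgen_swap:
  assumes "a < b"
  shows "Dgen n (xs @ a # b # ys) g = fps_X ^ (b - a - 1) * (Dgen n (xs @ b # a # ys) g :: 'a :: comm_ring_1 fps)"
  using assms
proof (induction n arbitrary: a b xs ys)
  case 0
  thus ?case by (simp add: Dgen_0)
next
  case (Suc n)
  define w where "w zs = (fps_X ^ pair_sum mark_stat zs * Dgen n (map lower zs) g :: 'a fps)" for zs
  have main: "w (us @ (a, d) # (b, e) # vs) = fps_X ^ (b - a - 1) * w (us @ (b, e) # (a, d) # vs)"
    if "d \<longrightarrow> 0 < a" for us d e vs
  proof -
    let ?p = "(a, d)" and ?q = "(b, e)"
    let ?A = "pair_sum mark_stat (us @ ?p # ?q # vs)" and ?B = "pair_sum mark_stat (us @ ?q # ?p # vs)"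
    let ?D = "\<lambda>p q. Dgen n (map lower us @ p # q # map lower vs) g :: 'a fps"
    have swap: "?A + mark_stat ?q ?p = ?B + mark_stat ?p ?q" by (rule pair_sum_swap)
    have qp: "mark_stat ?q ?p = of_bool (\<not> e \<and> d)" using Suc.prems by (auto simp: mark_stat_def)
    have pq: "mark_stat ?p ?q = of_bool (\<not> d \<and> e \<and> Suc a < b)" using Suc.prems by (auto simp: mark_stat_def)
    have "fps_X ^ ?A * ?D (lower ?p) (lower ?q) = fps_X ^ (b - a - 1) * (fps_X ^ ?B * ?D (lower ?q) (lower ?p))"
    proof (cases "lower ?p < lower ?q")
      case True
      \<comment> \<open>If exactly one of the two columns is marked, the difference of heights
        changes by one; the change of \<open>mark_stat\<close> under the exchange compensates for
        this.\<close>
      have "?A + (lower ?q - lower ?p - 1) = (b - a - 1) + ?B"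
        using swap qp pq True Suc.prems that
        by (cases d; cases e; simp add: lower_def of_bool_def split: if_splits)
      thus ?thesis
        by (simp add: Suc.IH[OF True] mult.assoc[symmetric] power_add[symmetric])
    next
      case False
      \<comment> \<open>Only \<open>\<not> d\<close>, \<open>e\<close> and \<open>b = Suc a\<close>
        remain. Both lowered heights equal \<open>a\<close>, and the exception in
        \<open>mark_stat\<close> makes the pair free in either order.\<close>
      hence "lower ?p = lower ?q" "?A = (b - a - 1) + ?B"
        using swap qp pq Suc.prems that by (cases d; cases e; simp add: lower_def)+
      thus ?thesis by (simp add: mult.assoc[symmetric] power_add[symmetric])
    qed
    thus ?thesis by (simp add: w_def)
  qed
  let ?T = "\<lambda>a b. {(us, d, e, vs). map fst us = xs \<and> map fst vs = ys \<and>
        us @ (a, d) # (b, e) # vs \<in> marks (xs @ a # b # ys) (g (Suc n))}"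
  have "Dgen (Suc n) (xs @ a # b # ys) g = (\<Sum>(us, d, e, vs)\<in>?T a b. w (us @ (a, d) # (b, e) # vs))"
    unfolding Dgen_Suc w_def by (rule sum_marks_append2)
  also have "\<dots> = (\<Sum>(us, d, e, vs)\<in>?T b a. fps_X ^ (b - a - 1) * w (us @ (b, d) # (a, e) # vs))"
    by (rule sum.reindex_bij_witness[where
        i = "\<lambda>(us, d, e, vs). (us, e, d, vs)" and j = "\<lambda>(us, d, e, vs). (us, e, d, vs)"])
      (auto simp: marks_def main)
  also have "\<dots> = fps_X ^ (b - a - 1) * (\<Sum>(us, d, e, vs)\<in>?T b a. w (us @ (b, d) # (a, e) # vs))"
    by (simp add: sum_distrib_left case_prod_unfold)
  also have "(\<Sum>(us, d, e, vs)\<in>?T b a. w (us @ (b, d) # (a, e) # vs)) = Dgen (Suc n) (xs @ b # a # ys) g"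
    unfolding Dgen_Suc w_def by (rule sum_marks_append2[symmetric])
  finally show ?case .
qed

text \<open>For heights \<open>h\<close> and \<open>Suc h\<close> the factor in
  \<open>Dgen_swap\<close> is 1, so \<open>h\<close> may move to the right past every entry
  \<open>Suc h\<close>. The prefix \<open>xs\<close> is arbitrary because the induction moves
  \<open>t\<close> into it.\<close>

lemma Dgen_insert:
  assumes "sorted_wrt (\<ge>) ts" "\<forall>t\<in>set ts. t \<le> Suc h"
  shows "\<exists>\<eta>. mset \<eta> = mset (h # ts) \<and> sorted_wrt (\<ge>) \<eta> \<and>
    (\<forall>xs. Dgen n (xs @ h # ts) g = (Dgen n (xs @ \<eta>) g :: 'a :: comm_ring_1 fps))"
  using assms
proof (induction ts)
  case Nil
  show ?case by (intro exI[of _ "[h]"]) simp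
next
  case (Cons t ts)
  show ?case
  proof (cases "t \<le> h")
    case True
    thus ?thesis using Cons.prems by (intro exI[of _ "h # t # ts"]) auto
  next
    case False
    hence t: "t = Suc h" using Cons.prems by simp
    from Cons obtain \<eta> where \<eta>: "mset \<eta> = mset (h # ts)" "sorted_wrt (\<ge>) \<eta>"
      "\<forall>xs. Dgen n (xs @ h # ts) g = (Dgen n (xs @ \<eta>) g :: 'a fps)" by auto
    have "Dgen n (xs @ h # t # ts) g = (Dgen n (xs @ t # \<eta>) g :: 'a fps)" for xs
      using Dgen_swap[of h t n xs ts g, where 'a = 'a] \<eta>(3)[rule_format, of "xs @ [t]"] t by simp
    moreover have "set \<eta> = set (h # ts)" using \<eta>(1) mset_eq_setD by blast
    hence "sorted_wrt (\<ge>) (t # \<eta>)" using \<eta>(2) Cons.prems t by auto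
    ultimately show ?thesis using \<eta>(1) by (intro exI[of _ "t # \<eta>"]) auto
  qed
qed

text \<open>Insertion sort: the hypothesis ensures that only heights differing by one ever have to
  be exchanged.\<close>

lemma Dgen_sort:
  assumes "sorted_wrt (\<lambda>a b. b \<le> Suc a) \<eta>"
  shows "\<exists>\<eta>'. mset \<eta>' = mset \<eta> \<and> sorted_wrt (\<ge>) \<eta>' \<and>
    (\<forall>xs. Dgen n (xs @ \<eta>) g = (Dgen n (xs @ \<eta>') g :: 'a :: comm_ring_1 fps))"
  using assms
proof (induction \<eta>)
  case (Cons h \<eta>)
  then obtain ts where ts: "mset ts = mset \<eta>" "sorted_wrt (\<ge>) ts"
    "\<forall>xs. Dgen n (xs @ \<eta>) g = (Dgen n (xs @ ts) g :: 'a fps)" by auto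
  have "set ts = set \<eta>" using ts(1) mset_eq_setD by blast
  hence "\<forall>t\<in>set ts. t \<le> Suc h" using Cons.prems by auto
  from Dgen_insert[OF ts(2) this, where n = n and g = g] obtain \<eta>' where \<eta>': "mset \<eta>' = mset (h # ts)" "sorted_wrt (\<ge>) \<eta>'"
    "\<forall>xs. Dgen n (xs @ h # ts) g = (Dgen n (xs @ \<eta>') g :: 'a fps)" by blast
  have "Dgen n (xs @ h # \<eta>) g = (Dgen n (xs @ \<eta>') g :: 'a fps)" for xs
    using \<eta>'(3) ts(3)[rule_format, of "xs @ [h]"] by simp
  thus ?case using \<eta>' ts(1) by (intro exI[of _ \<eta>']) auto
qed simp

section \<open>Gaussian binomial coefficients\<close>

text \<open>Congruence modulo \<open>q^(e+1)\<close>.\<close>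

definition fps_cong :: "nat \<Rightarrow> 'a::zero fps \<Rightarrow> 'a fps \<Rightarrow> bool" where
  "fps_cong e f g \<longleftrightarrow> (\<forall>i\<le>e. fps_nth f i = fps_nth g i)"

lemma fps_cong_refl: "fps_cong e f f"
  and fps_cong_sym: "fps_cong e f g \<Longrightarrow> fps_cong e g f"
  and fps_cong_trans [trans]: "fps_cong e f g \<Longrightarrow> fps_cong e g h \<Longrightarrow> fps_cong e f h"
  by (simp_all add: fps_cong_def)

lemma fps_cong_mult:
  fixes f :: "'a::comm_ring_1 fps"
  assumes "fps_cong e f f'" "fps_cong e g g'"
  shows "fps_cong e (f * g) (f' * g')"
  using assms by (auto simp: fps_cong_def fps_mult_nth intro!: sum.cong)

lemma fps_cong_sum:
  assumes "\<And>x. x \<in> A \<Longrightarrow> fps_cong e (f x) (g x)"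
  shows "fps_cong e (sum f A) (sum g A)"
  using assms by (auto simp: fps_cong_def fps_sum_nth intro!: sum.cong)

lemma fps_cong_X_power_mult_0:
  "e < k \<Longrightarrow> fps_cong e (fps_X ^ k * f) (0 :: 'a::comm_ring_1 fps)"
  by (simp add: fps_cong_def fps_X_power_mult_nth)

definition winv :: "bool \<Rightarrow> bool \<Rightarrow> nat" where
  "winv x y = of_bool (\<not> x \<and> y)"

definition words :: "nat \<Rightarrow> nat \<Rightarrow> bool list set" where
  "words m c = {bs. length bs = m \<and> length (filter (\<lambda>b. b) bs) = c}"

text \<open>The Gaussian binomial coefficient, as the generating function of words with
  \<open>c\<close> letters \<open>True\<close>, counted by pairs with \<open>False\<close> before
  \<open>True\<close>.\<close>

definition gauss :: "nat \<Rightarrow> nat \<Rightarrow> 'a::comm_ring_1 fps" where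
  "gauss m c = (\<Sum>bs\<in>words m c. fps_X ^ pair_sum winv bs)"

lemma finite_words: "finite (words m c)"
  by (rule finite_subset[OF _ finite_lists_length_eq[of UNIV m]]) (auto simp: words_def)

lemma words_empty: "m < c \<Longrightarrow> words m c = {}"
  by (auto simp: words_def simp flip: not_le)

lemma winv_Cons: "pair_sum winv (b # bs) = (if b then 0 else length (filter (\<lambda>b. b) bs)) + pair_sum winv bs"
proof -
  have "sum_list (map (winv b) bs) = (if b then 0 else length (filter (\<lambda>b. b) bs))"
    by (induction bs) (auto simp: winv_def)
  thus ?thesis by simp
qed

lemma gauss_0_right: "gauss m 0 = 1"
proof -
  have "words m 0 = {replicate m False}"
    by (auto simp: words_def filter_empty_conv intro: replicate_eqI)
  moreover have "pair_sum winv (replicate m False) = 0"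
    by (induction m) (simp_all add: winv_Cons del: pair_sum.simps(2))
  ultimately show ?thesis by (simp add: gauss_def)
qed

text \<open>The q-Pascal recursion by the first letter: a leading \<open>False\<close> precedes all
  \<open>Suc c\<close> letters \<open>True\<close>.\<close>

lemma gauss_Suc_Suc: "gauss (Suc m) (Suc c) = gauss m c + fps_X ^ Suc c * gauss m (Suc c)"
proof -
  have W: "words (Suc m) (Suc c) = (#) True ` words m c \<union> (#) False ` words m (Suc c)"
  proof (rule set_eqI)
    fix bs
    show "bs \<in> words (Suc m) (Suc c) \<longleftrightarrow> bs \<in> (#) True ` words m c \<union> (#) False ` words m (Suc c)"
      by (cases bs; cases "hd bs") (auto simp: words_def)
  qed
  have "gauss (Suc m) (Suc c) = (\<Sum>bs\<in>(#) True ` words m c. fps_X ^ pair_sum winv bs) +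
      (\<Sum>bs\<in>(#) False ` words m (Suc c). fps_X ^ pair_sum winv bs :: 'a fps)"
    unfolding gauss_def W by (rule sum.union_disjoint) (auto simp: finite_words)
  also have "(\<Sum>bs\<in>(#) True ` words m c. fps_X ^ pair_sum winv bs) = (gauss m c :: 'a fps)"
    by (subst sum.reindex) (auto simp: gauss_def winv_Cons simp del: pair_sum.simps)
  also have "(\<Sum>bs\<in>(#) False ` words m (Suc c). fps_X ^ pair_sum winv bs) =
      (fps_X ^ Suc c * gauss m (Suc c) :: 'a fps)"
  proof -
    have "fps_X ^ pair_sum winv (False # bs) = (fps_X ^ Suc c * fps_X ^ pair_sum winv bs :: 'a fps)"
      if "bs \<in> words m (Suc c)" for bs
    proof -
      have "pair_sum winv (False # bs) = Suc c + pair_sum winv bs"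
        using that unfolding winv_Cons by (simp add: words_def)
      thus ?thesis by (simp only: power_add)
    qed
    thus ?thesis
      unfolding gauss_def sum_distrib_left
      by (subst sum.reindex) (auto simp del: pair_sum.simps power_Suc intro!: sum.cong)
  qed
  finally show ?thesis .
qed

definition qpoch :: "nat \<Rightarrow> 'a::comm_ring_1 fps" where
  "qpoch m = (\<Prod>k<m. 1 - fps_X ^ Suc k)"

lemma qpoch_Suc: "qpoch (Suc m) = qpoch m * (1 - fps_X ^ Suc m)"
  by (simp add: qpoch_def)

text \<open>The product formula without division. The induction on \<open>c + d\<close> combines the
  q-Pascal recursion with (1 - q^c) + q^c (1 - q^d) = 1 - q^(c+d).\<close>

lemma gauss_qpoch: "gauss (c + d) c * qpoch c * qpoch d = qpoch (c + d)"
proof (induction "c + d" arbitrary: c d)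
  case 0
  thus ?case by (simp add: gauss_0_right qpoch_def)
next
  case (Suc m)
  show ?case
  proof (cases c)
    case 0
    thus ?thesis by (simp add: gauss_0_right qpoch_def)
  next
    case c: (Suc c')
    have 1: "gauss (c' + d) c' * qpoch c' * qpoch d = (qpoch m :: 'a fps)"
      using Suc.hyps(1)[of c' d] Suc.hyps(2) c by simp
    show ?thesis
    proof (cases d)
      case 0
      have "gauss (Suc c') (Suc c') = (gauss c' c' :: 'a fps)"
        by (simp add: gauss_Suc_Suc) (simp add: gauss_def words_empty)
      hence "gauss (c + d) c * qpoch c * qpoch d =
          (gauss (c' + d) c' * qpoch c' * qpoch d) * (1 - fps_X ^ Suc c' :: 'a fps)"
        unfolding 0 c by (simp add: qpoch_Suc mult_ac del: power_Suc)
      also have "\<dots> = qpoch (c + d)"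
        using 0 c Suc.hyps(2) unfolding 1 by (simp add: qpoch_Suc del: power_Suc)
      finally show ?thesis .
    next
      case d: (Suc d')
      have 2: "gauss (c + d') c * qpoch c * qpoch d' = (qpoch m :: 'a fps)"
        using Suc.hyps(1)[of c d'] Suc.hyps(2) d by simp
      have m: "c' + d = m" "c + d' = m" "c + d = Suc m" using Suc.hyps(2) c d by simp_all
      have "gauss (c + d) c * qpoch c * qpoch d =
          (gauss m c' * qpoch c' * qpoch d) * (1 - fps_X ^ c) +
          fps_X ^ c * (1 - fps_X ^ d) * (gauss m c * qpoch c * qpoch d' :: 'a fps)"
        unfolding m(3) unfolding c d gauss_Suc_Suc qpoch_Suc by (simp add: algebra_simps)
      also have "\<dots> = qpoch m * (1 - fps_X ^ c * fps_X ^ d)"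
        using 1 2 unfolding m by (simp add: algebra_simps)
      also have "fps_X ^ c * fps_X ^ d = (fps_X ^ Suc m :: 'a fps)"
        unfolding power_add[symmetric] m(3) ..
      finally show ?thesis unfolding m(3) qpoch_Suc .
    qed
  qed
qed

section \<open>Convergence of Gaussian binomial coefficients to the inverse Euler product\<close>

lemma qpoch_stable: "i \<le> m \<Longrightarrow> fps_nth (qpoch m) i = fps_nth (qpoch i) i"
proof (induction m rule: dec_induct)
  case (step m)
  thus ?case by (simp add: qpoch_Suc right_diff_distrib fps_X_power_mult_right_nth del: power_Suc)
qed simp

definition euler_inv :: "lpoly fps" where
  "euler_inv = fps_right_inverse euler_prod 1"

lemma euler_prod_mult_inv: "euler_prod * euler_inv = 1"
  unfolding euler_inv_def by (rule fps_right_inverse) (simp add: euler_prod_nth_0)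

lemma qpoch_cong_euler_prod: "e \<le> m \<Longrightarrow> fps_cong e (qpoch m) euler_prod"
  unfolding fps_cong_def
proof (intro allI impI)
  fix i assume "e \<le> m" "i \<le> e"
  have "\<forall>\<^sub>F N in sequentially. fps_nth (\<Prod>k\<le>N. 1 - fps_X ^ Suc k :: lpoly fps) i = fps_nth euler_prod i"
    using euler_prod_LIMSEQ unfolding tendsto_fps_iff by blast
  then obtain N where "N \<ge> i" "fps_nth (qpoch (Suc N)) i = fps_nth euler_prod i"
    unfolding eventually_sequentially qpoch_def lessThan_Suc_atMost by (metis nle_le)
  thus "fps_nth (qpoch m) i = fps_nth euler_prod i"
    using qpoch_stable[of i m, where 'a = "(nat \<Rightarrow>\<^sub>0 int) \<Rightarrow>\<^sub>0 int"] qpoch_stable[of i "Suc N", where 'a = "(nat \<Rightarrow>\<^sub>0 int) \<Rightarrow>\<^sub>0 int"] \<open>e \<le> m\<close> \<open>i \<le> e\<close> by simp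
qed

text \<open>To avoid division, two factors \<open>euler_prod\<close> and their inverses are
  inserted. Modulo \<open>q^(e+1)\<close> these factors may be replaced by \<open>qpoch c\<close>
  and \<open>qpoch d\<close>, and \<open>gauss_qpoch\<close> leaves \<open>qpoch (c + d)\<close>,
  which is again \<open>euler_prod\<close> to this precision.\<close>

lemma gauss_cong:
  assumes "e \<le> c" "e \<le> d"
  shows "fps_cong e (gauss (c + d) c) euler_inv"
proof -
  have E: "fps_cong e (qpoch m) euler_prod" if "e \<le> m" for m
    using that by (rule qpoch_cong_euler_prod)
  have "gauss (c + d) c = (gauss (c + d) c * euler_prod * euler_prod) * (euler_inv * euler_inv)"
  proof -
    have "(f * euler_prod * euler_prod) * (euler_inv * euler_inv) =
        f * (euler_prod * euler_inv) * (euler_prod * euler_inv)" for f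
      by (simp only: mult_ac)
    thus ?thesis by (simp add: euler_prod_mult_inv)
  qed
  also have "fps_cong e \<dots> ((gauss (c + d) c * qpoch c * qpoch d) * (euler_inv * euler_inv))"
    by (intro fps_cong_mult fps_cong_refl E[THEN fps_cong_sym] assms)
  also have "fps_cong e \<dots> (euler_prod * (euler_inv * euler_inv))"
    unfolding gauss_qpoch using assms by (intro fps_cong_mult fps_cong_refl E) simp
  also have "\<dots> = euler_inv"
    using euler_prod_mult_inv by (simp add: mult.assoc[symmetric])
  finally show ?thesis .
qed

section \<open>Slack of a content under removal of the largest letter\<close>

text \<open>
  For equal sums, \<open>slack n 0\<close> means that the content lies in the permutohedron of the conjugate of \<open>\<eta>\<close>
  (Rado), since the sum of \<open>min h k\<close> is the sum of the \<open>k\<close> longest rows.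
\<close>
definition slack :: "nat \<Rightarrow> nat \<Rightarrow> nat list \<Rightarrow> (nat \<Rightarrow> nat) \<Rightarrow> bool" where
  "slack n M \<eta> g \<longleftrightarrow>
     (\<forall>I. I \<subseteq> {1..n} \<and> I \<noteq> {} \<and> I \<noteq> {1..n} \<longrightarrow> sum g I + M \<le> (\<Sum>h\<leftarrow>\<eta>. min h (card I)))"

abbreviation low_marked :: "nat \<Rightarrow> (nat \<times> bool) list \<Rightarrow> nat" where
  "low_marked k zs \<equiv> length (filter (\<lambda>z. snd z \<and> fst z \<le> k) zs)"

abbreviation high_unmarked :: "nat \<Rightarrow> (nat \<times> bool) list \<Rightarrow> nat" where
  "high_unmarked k zs \<equiv> length (filter (\<lambda>z. \<not> snd z \<and> k < fst z) zs)"

text \<open>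
  A cheap marking is almost an initial segment; the minimum of the two factors is what it costs in
  \<open>slack\<close>.
\<close>
lemma low_marked_high_unmarked_le:
  assumes "sorted_wrt (\<lambda>z z'. fst z' \<le> fst z) zs"
  shows "low_marked k zs * high_unmarked k zs \<le> pair_sum winv (map snd zs)"
  using assms
proof (induction zs)
  case (Cons z zs)
  have IH: "low_marked k zs * high_unmarked k zs \<le> pair_sum winv (map snd zs)"
    using Cons by simp
  have low: "low_marked k zs \<le> length (filter (\<lambda>b. b) (map snd zs))"
    by (induction zs) auto
  have zero: "high_unmarked k zs = 0" if "fst z \<le> k"
    using Cons.prems that by (fastforce simp: filter_empty_conv)
  show ?case
  proof (cases "snd z")
    case True
    thus ?thesis using IH zero by (cases "fst z \<le> k") (simp_all add: winv_Cons del: pair_sum.simps)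
  next
    case False
    thus ?thesis using IH low by (simp add: winv_Cons del: pair_sum.simps)
  qed
qed simp

text \<open>Lowering a marked column changes the minimum with \<open>k\<close> only if its height is
  at most \<open>k\<close>. This transfers the slack inequality for a set \<open>I\<close> of size
  \<open>k\<close>; the next lemma transfers the one for \<open>I\<close> with the largest letter
  added. Each gives a bound for \<open>I\<close> after the removal, and the better of the two is
  used.\<close>

lemma lower_min_low:
  assumes "\<forall>z\<in>set zs. snd z \<longrightarrow> 0 < fst z"
  shows "(\<Sum>z\<leftarrow>zs. min (lower z) k) + low_marked k zs = (\<Sum>z\<leftarrow>zs. min (fst z) k)"
  using assms by (induction zs) (auto simp: lower_def)

text \<open>Passing from \<open>Suc k\<close> to \<open>k\<close> costs one for every column higher
  than \<open>k\<close>; a marked column, being lowered as well, always loses exactly one.\<close>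

lemma lower_min_high:
  assumes "\<forall>z\<in>set zs. snd z \<longrightarrow> 0 < fst z"
  shows "(\<Sum>z\<leftarrow>zs. min (lower z) k) + high_unmarked k zs + length (filter snd zs) =
    (\<Sum>z\<leftarrow>zs. min (fst z) (Suc k))"
  using assms by (induction zs) (auto simp: lower_def)

lemma lower_sum:
  assumes "\<forall>z\<in>set zs. snd z \<longrightarrow> 0 < fst z"
  shows "(\<Sum>z\<leftarrow>zs. lower z) + length (filter snd zs) = (\<Sum>z\<leftarrow>zs. fst z)"
  using assms by (induction zs) (auto simp: lower_def)

section \<open>The generating function for an interior content\<close>

text \<open>With one letter the heights determine the filling, and the letter 1 has rank 0 in every
  column.\<close>

lemma Dgen_1:
  assumes "\<forall>h\<in>set \<eta>. h \<le> 1" "sum_list \<eta> = g 1"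
  shows "Dgen 1 \<eta> g = 1"
proof -
  define f :: "nat \<Rightarrow> nat set" where "f h = (if h = 0 then {} else {1})" for h
  have 1: "map f (map card Cs) = Cs" if "\<forall>A\<in>set Cs. A \<subseteq> {1}" for Cs :: "nat set list"
  proof -
    have "f (card A) = A" if "A \<subseteq> {1}" for A
      using that by (auto simp: f_def subset_singleton_iff)
    thus ?thesis using that by (simp add: map_idI)
  qed
  have 2: "map card (map f \<eta>) = \<eta>"
    using assms(1) by (intro nth_equalityI) (auto simp: f_def le_Suc_eq all_set_conv_all_nth)
  have 3: "occ 1 (map f \<eta>) = sum_list \<eta>"
    using assms(1) by (induction \<eta>) (auto simp: f_def)
  have 4: "\<forall>A\<in>set (map f \<eta>). A \<subseteq> {1}" by (auto simp: f_def)
  have "Cs \<in> with_content 1 \<eta> g \<longleftrightarrow> Cs = map f \<eta>" for Cs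
  proof
    assume "Cs \<in> with_content 1 \<eta> g"
    thus "Cs = map f \<eta>" using 1[of Cs] by (auto simp: with_content_def fillings_def)
  next
    assume "Cs = map f \<eta>"
    thus "Cs \<in> with_content 1 \<eta> g"
      using 2 3 4 assms(2) by (simp add: with_content_def fillings_def del: map_map One_nat_def)
  qed
  hence "with_content 1 \<eta> g = {map f \<eta>}" by blast
  moreover have "pair_sum dcol (map f \<eta>) = 0"
  proof -
    have "dcol (f h) (f k) = 0" for h k by (auto simp: dcol_def f_def)
    thus ?thesis by (induction \<eta>) simp_all
  qed
  ultimately show ?thesis by (simp add: Dgen_def)
qed

text \<open>Induction on the number of letters. Modulo \<open>q^(e+1)\<close> only markings with at
  most \<open>e\<close> inversions matter; each costs at most \<open>e\<close> of the slack, so the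
  budget \<open>n * e < M\<close> suffices for all removals. Every letter removed contributes one
  Gaussian binomial coefficient.\<close>

lemma Dgen_interior:
  assumes "1 \<le> n" "sorted_wrt (\<lambda>a b. b \<le> Suc a) \<eta>" "\<forall>h\<in>set \<eta>. h \<le> n"
    "sum_list \<eta> = sum g {1..n}" "slack n M \<eta> g" "n * e < M"
  shows "fps_cong e (Dgen n \<eta> g) (euler_inv ^ (n - 1))"
  using assms
proof (induction n arbitrary: \<eta> M rule: nat_induct_at_least)
  case base
  thus ?case by (simp add: Dgen_1 fps_cong_refl del: One_nat_def)
next
  case (Suc n)
  obtain \<theta> where \<theta>: "mset \<theta> = mset \<eta>" "sorted_wrt (\<ge>) \<theta>"
    "\<forall>xs. Dgen (Suc n) (xs @ \<eta>) g = (Dgen (Suc n) (xs @ \<theta>) g :: lpoly fps)"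
    using Dgen_sort[OF Suc.prems(1)] by blast
  have sum_eq: "sum_list (map f \<eta>) = sum_list (map f \<theta>)" for f :: "nat \<Rightarrow> nat"
    using \<theta>(1) by (metis mset_map sum_mset_sum_list)
  have le: "\<forall>h\<in>set \<theta>. h \<le> Suc n" using Suc.prems(2) \<theta>(1) mset_eq_setD by blast
  have sumg: "sum_list \<theta> = sum g {1..n} + g (Suc n)" using Suc.prems(3) sum_eq[of id] by simp
  have sl: "sum g I + M \<le> (\<Sum>h\<leftarrow>\<theta>. min h (card I))"
    if "I \<subseteq> {1..Suc n}" "I \<noteq> {}" "I \<noteq> {1..Suc n}" for I
    using Suc.prems(4) that unfolding slack_def sum_eq by blast
  have "Suc n \<in> {1..Suc n}" "1 \<in> {1..Suc n}" "1 \<notin> {Suc n}" "1 \<in> {1..n}" "Suc n \<notin> {1..n}"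
    using Suc.hyps by simp_all
  hence "{Suc n} \<noteq> {1..Suc n}" "{1..n} \<noteq> {1..Suc n}" by metis+
  moreover have "{1..n} \<noteq> {}" using Suc.hyps by simp
  \<comment> \<open>The two extreme cases of the slack condition. They force cheap markings to be
    legitimate, bound the lowered heights and make both parameters of the Gaussian binomial
    large.\<close>
  ultimately have sl_top: "sum g {Suc n} + M \<le> (\<Sum>h\<leftarrow>\<theta>. min h 1)"
    and sl_bot: "sum g {1..n} + M \<le> (\<Sum>h\<leftarrow>\<theta>. min h n)"
    using sl[of "{Suc n}"] sl[of "{1..n}"] by simp_all
  define m where "m = length \<theta>"
  define c where "c = g (Suc n)"
  have M: "e < M" "n * e < M - e" using Suc.prems(5) Suc.hyps by auto

  \<comment> \<open>Every word with few inversions is a legitimate marking whose lowered columns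
    again satisfy the induction hypothesis, with slack \<open>M - e\<close>.\<close>
  have valid: "zip \<theta> bs \<in> marks \<theta> c \<and>
      fps_cong e (Dgen n (map lower (zip \<theta> bs)) g) (euler_inv ^ (n - 1))"
    if bs: "bs \<in> words m c" and small: "pair_sum winv bs \<le> e" for bs
  proof -
    define zs where "zs = zip \<theta> bs"
    have zs: "map fst zs = \<theta>" "map snd zs = bs" using bs by (simp_all add: zs_def words_def m_def)
    have len: "length (filter snd zs) = c"
    proof -
      have "length (filter snd zs) = length (filter (\<lambda>b. b) (map snd zs))" by (simp add: filter_map o_def)
      thus ?thesis using bs zs(2) by (simp add: words_def)
    qed
    have sorted: "sorted_wrt (\<lambda>z z'. fst z' \<le> fst z) zs"
      using \<theta>(2) unfolding zs(1)[symmetric] by (simp add: sorted_wrt_map)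
    have prod: "low_marked k zs * high_unmarked k zs \<le> e" for k
      using low_marked_high_unmarked_le[OF sorted, of k] small zs(2) by simp
    have split: "low_marked k zs + length (filter (\<lambda>z. snd z \<and> k < fst z) zs) = c" for k
      unfolding len[symmetric] by (induction zs) auto
    have sum_fst: "(\<Sum>z\<leftarrow>zs. f (fst z)) = (\<Sum>h\<leftarrow>\<theta>. f h)" for f :: "nat \<Rightarrow> nat"
      unfolding zs(1)[symmetric] by (simp add: o_def)
    \<comment> \<open>At least \<open>M > e\<close> nonempty columns are unmarked, so a marked empty
      column would already force more than \<open>e\<close> inversions.\<close>
    have pos: "\<forall>z\<in>set zs. snd z \<longrightarrow> 0 < fst z"
    proof -
      have "sum g {Suc n} + M \<le> (\<Sum>h\<leftarrow>\<theta>. min h 1)" by (rule sl_top)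
      also have "\<dots> = (\<Sum>z\<leftarrow>zs. min (fst z) 1)" by (rule sum_fst[symmetric])
      also have "\<dots> = high_unmarked 0 zs + length (filter (\<lambda>z. snd z \<and> 0 < fst z) zs)"
        by (induction zs) auto
      also have "\<dots> \<le> high_unmarked 0 zs + c" using split[of 0] by linarith
      finally have "M \<le> high_unmarked 0 zs" by (simp add: c_def)
      hence "low_marked 0 zs = 0"
        using prod[of 0] M(1) by (cases "low_marked 0 zs") auto
      thus ?thesis by (auto simp: filter_empty_conv)
    qed
    \<comment> \<open>Dually, at least \<open>M > e\<close> marked columns have height at most
      \<open>n\<close>; an unmarked column of height \<open>Suc n\<close> would be too
      expensive.\<close>
    have le': "\<forall>z\<in>set zs. lower z \<le> n"
    proof -
      have "sum g {1..n} + M \<le> (\<Sum>h\<leftarrow>\<theta>. min h n)" by (rule sl_bot)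
      also have "\<dots> = (\<Sum>z\<leftarrow>zs. min (fst z) n)" by (rule sum_fst[symmetric])
      finally have "sum g {1..n} + M \<le> (\<Sum>z\<leftarrow>zs. min (fst z) n)" .
      moreover have "(\<Sum>z\<leftarrow>zs. min (fst z) n) + length (filter (\<lambda>z. n < fst z) zs) = (\<Sum>z\<leftarrow>zs. fst z)"
        using le unfolding zs(1)[symmetric] by (induction zs) (auto simp: min_def)
      moreover have "(\<Sum>z\<leftarrow>zs. fst z) = sum g {1..n} + c" using sum_fst[of id] sumg by (simp add: c_def)
      moreover have "length (filter (\<lambda>z. n < fst z) zs) =
          high_unmarked n zs + length (filter (\<lambda>z. snd z \<and> n < fst z) zs)"
        by (induction zs) auto
      ultimately have "M \<le> low_marked n zs" using split[of n] by linarith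
      hence "high_unmarked n zs = 0"
        using prod[of n] M(1) by (cases "high_unmarked n zs") auto
      hence "\<forall>z\<in>set zs. n < fst z \<longrightarrow> snd z" by (auto simp: filter_empty_conv)
      moreover have "\<forall>z\<in>set zs. fst z \<le> Suc n" using le unfolding zs(1)[symmetric] by auto
      ultimately show ?thesis by (fastforce simp: lower_def)
    qed
    have "slack n (M - e) (map lower zs) g"
      unfolding slack_def
    proof (intro allI impI, elim conjE)
      fix I assume I: "I \<subseteq> {1..n}" "I \<noteq> {}" "I \<noteq> {1..n}"
      define k where "k = card I"
      have fin: "finite I" and notin: "Suc n \<notin> I" using I(1) finite_subset by auto
      have 1: "sum g I + M \<le> (\<Sum>z\<leftarrow>zs. min (fst z) k)"
      proof -
        have "I \<subseteq> {1..Suc n}" "I \<noteq> {1..Suc n}" using I notin by auto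
        thus ?thesis using sl[of I] I(2) sum_fst[of "\<lambda>h. min h k"] by (simp add: k_def)
      qed
      have "sum g (insert (Suc n) I) + M \<le> (\<Sum>h\<leftarrow>\<theta>. min h (card (insert (Suc n) I)))"
      proof (rule sl)
        obtain i where "i \<in> {1..n}" "i \<notin> I" using I by blast
        hence "i \<in> {1..Suc n}" "i \<notin> insert (Suc n) I" by simp_all
        thus "insert (Suc n) I \<noteq> {1..Suc n}" by metis
      qed (use I in auto)
      hence 2: "sum g I + c + M \<le> (\<Sum>z\<leftarrow>zs. min (fst z) (Suc k))"
        using fin notin sum_fst[of "\<lambda>h. min h (Suc k)"] by (simp add: k_def c_def)
      \<comment> \<open>The product of the two numbers is at most \<open>e\<close>, hence so is one
        of them; it bounds the loss of slack at \<open>I\<close>.\<close>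
      have "low_marked k zs \<le> e \<or> high_unmarked k zs \<le> e"
      proof (cases "high_unmarked k zs")
        case (Suc y)
        thus ?thesis using prod[of k] by auto
      qed simp
      hence "sum g I + (M - e) \<le> (\<Sum>z\<leftarrow>zs. min (lower z) k)"
        using 1 2 lower_min_low[OF pos, of k] lower_min_high[OF pos, of k] len M(1) by linarith
      thus "sum g I + (M - e) \<le> (\<Sum>h\<leftarrow>map lower zs. min h (card I))"
        by (simp add: o_def k_def)
    qed
    moreover have "sum_list (map lower zs) = sum g {1..n}"
      using lower_sum[OF pos] len sum_fst[of id] sumg by (simp add: c_def)
    \<comment> \<open>Lowering some entries of a decreasing list by one can create an ascent of at
      most one, which is what the hypothesis on \<open>\<eta>\<close> permits.\<close>
    moreover have "sorted_wrt (\<lambda>a b. b \<le> Suc a) (map lower zs)"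
      unfolding sorted_wrt_map
      by (rule sorted_wrt_mono_rel[OF _ sorted]) (auto simp: lower_def)
    ultimately have "fps_cong e (Dgen n (map lower zs) g) (euler_inv ^ (n - 1))"
      using le' M by (intro Suc.IH[where M = "M - e"]) auto
    thus ?thesis using pos len zs by (simp add: marks_def zs_def[symmetric])
  qed

  \<comment> \<open>Along decreasing heights the exception in \<open>mark_stat\<close> never occurs,
    so only the order of the marks matters.\<close>
  have stat: "pair_sum mark_stat zs = pair_sum winv (map snd zs)" if "map fst zs = \<theta>" for zs
  proof -
    have "sorted_wrt (\<lambda>z z'. fst z' \<le> fst z) zs"
      using \<theta>(2) unfolding that[symmetric] by (simp add: sorted_wrt_map)
    thus ?thesis
    proof (induction zs)
      case (Cons z zs)
      hence "(\<Sum>z'\<leftarrow>zs. mark_stat z z') = (\<Sum>z'\<leftarrow>zs. winv (snd z) (snd z'))"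
        by (intro arg_cong[where f = sum_list] map_cong refl) (auto simp: mark_stat_def winv_def)
      thus ?case using Cons by (simp add: o_def)
    qed simp
  qed
  have zip_eq: "zip \<theta> (map snd zs) = zs" if "map fst zs = \<theta>" for zs :: "(nat \<times> bool) list"
    unfolding that[symmetric] by (rule zip_map_fst_snd)
  have "Dgen (Suc n) \<eta> g = (Dgen (Suc n) \<theta> g :: lpoly fps)" using \<theta>(3)[rule_format, of "[]"] by simp
  also have "\<dots> = (\<Sum>bs | bs \<in> words m c \<and> zip \<theta> bs \<in> marks \<theta> c.
      fps_X ^ pair_sum winv bs * Dgen n (map lower (zip \<theta> bs)) g)"
    unfolding Dgen_Suc
  proof (rule sum.reindex_bij_witness[where i = "zip \<theta>" and j = "map snd"], goal_cases)
    case (1 zs)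
    thus ?case by (simp add: marks_def zip_eq)
  next
    case (2 zs)
    hence "map fst zs = \<theta>" "length (filter snd zs) = c" by (simp_all add: marks_def c_def)
    hence "map snd zs \<in> words m c" by (auto simp: words_def m_def filter_map o_def)
    thus ?case using 2 zip_eq[of zs] by (simp add: marks_def c_def)
  next
    case (3 bs)
    thus ?case by (simp add: words_def m_def)
  next
    case (4 bs)
    thus ?case by (simp add: c_def)
  next
    case (5 zs)
    hence "map fst zs = \<theta>" by (simp add: marks_def)
    thus ?case using stat[of zs] zip_eq[of zs] by simp
  qed
  also have "\<dots> = (\<Sum>bs\<in>words m c. if zip \<theta> bs \<in> marks \<theta> c
      then fps_X ^ pair_sum winv bs * Dgen n (map lower (zip \<theta> bs)) g else 0)"
    by (rule sum.inter_filter[OF finite_words])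
  \<comment> \<open>A word with more than \<open>e\<close> inversions contributes zero at this
    precision on both sides, whether or not it is a legitimate marking.\<close>
  also have "fps_cong e \<dots> (\<Sum>bs\<in>words m c. fps_X ^ pair_sum winv bs * euler_inv ^ (n - 1))"
  proof (rule fps_cong_sum)
    fix bs assume bs: "bs \<in> words m c"
    show "fps_cong e (if zip \<theta> bs \<in> marks \<theta> c
      then fps_X ^ pair_sum winv bs * Dgen n (map lower (zip \<theta> bs)) g else 0)
      (fps_X ^ pair_sum winv bs * euler_inv ^ (n - 1))"
    proof (cases "pair_sum winv bs \<le> e")
      case True
      thus ?thesis using valid[OF bs True] by (auto intro!: fps_cong_mult fps_cong_refl)
    next
      case False
      hence zero: "fps_cong e (fps_X ^ pair_sum winv bs * f) (0 :: lpoly fps)" for f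
        by (intro fps_cong_X_power_mult_0) simp
      have "fps_cong e (if zip \<theta> bs \<in> marks \<theta> c
        then fps_X ^ pair_sum winv bs * Dgen n (map lower (zip \<theta> bs)) g else 0) (0 :: lpoly fps)"
        using zero by (simp add: fps_cong_refl)
      thus ?thesis by (rule fps_cong_trans[OF _ fps_cong_sym[OF zero]])
    qed
  qed
  also have "\<dots> = gauss m c * euler_inv ^ (n - 1)"
    by (simp add: gauss_def sum_distrib_right)
  also have "fps_cong e \<dots> (euler_inv * euler_inv ^ (n - 1))"
  \<comment> \<open>Both \<open>c\<close> and \<open>m - c\<close> are at least \<open>M\<close>,
    hence larger than \<open>e\<close>.\<close>
  proof (rule fps_cong_mult[OF _ fps_cong_refl])
    have "sum g {Suc n} + M \<le> (\<Sum>h\<leftarrow>\<theta>. min h 1)" by (rule sl_top)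
    also have "\<dots> \<le> m" unfolding m_def by (induction \<theta>) auto
    finally have 1: "c + M \<le> m" by (simp add: c_def)
    have "sum g {1..n} + M \<le> (\<Sum>h\<leftarrow>\<theta>. min h n)" by (rule sl_bot)
    also have "\<dots> \<le> sum_list \<theta>" by (induction \<theta>) auto
    finally have "M \<le> c" using sumg by (simp add: c_def)
    thus "fps_cong e (gauss m c) euler_inv"
      using 1 M(1) gauss_cong[of e c "m - c"] by simp
  qed
  also have "euler_inv * euler_inv ^ (n - 1) = euler_inv ^ (Suc n - 1)"
    using Suc.hyps by (simp flip: power_Suc)
  finally show ?case .
qed

section \<open>Column strict fillings as lists of column sets\<close>

definition height :: "(nat \<Rightarrow> nat) \<Rightarrow> nat \<Rightarrow> nat" where
  "height \<mu> c = card {r. (r, c) \<in> dg \<mu>}"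

definition heights :: "(nat \<Rightarrow> nat) \<Rightarrow> nat list" where
  "heights \<mu> = map (height \<mu>) [1..<Suc (\<mu> 1)]"

definition col_set :: "(nat \<Rightarrow> nat) \<Rightarrow> (cell \<Rightarrow> nat) \<Rightarrow> nat \<Rightarrow> nat set" where
  "col_set \<mu> F c = (\<lambda>r. F (r, c)) ` {1..height \<mu> c}"

definition col_sets :: "(nat \<Rightarrow> nat) \<Rightarrow> (cell \<Rightarrow> nat) \<Rightarrow> nat set list" where
  "col_sets \<mu> F = map (col_set \<mu> F) [1..<Suc (\<mu> 1)]"

definition fill :: "(nat \<Rightarrow> nat) \<Rightarrow> nat set list \<Rightarrow> cell \<Rightarrow> nat" where
  "fill \<mu> Cs = (\<lambda>(r, c) \<in> dg \<mu>. sorted_list_of_set (Cs ! (c - 1)) ! (r - 1))"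

section \<open>Double counting over pairs of columns\<close>

definition upper_pairs :: "nat \<Rightarrow> (nat \<times> nat) set" where
  "upper_pairs m = {(c, c'). 1 \<le> c \<and> c < c' \<and> c' \<le> m}"

lemma finite_upper_pairs [simp]: "finite (upper_pairs m)"
  by (rule finite_subset[of _ "{1..m} \<times> {1..m}"]) (auto simp: upper_pairs_def)

lemma pair_sum_map_upt:
  "pair_sum w (map f [1..<Suc m]) = (\<Sum>(c, c')\<in>upper_pairs m. w (f c) (f c'))"
proof (induction m)
  case 0
  show ?case by (auto simp: upper_pairs_def intro!: sum.neutral)
next
  case (Suc m)
  have "upper_pairs (Suc m) = upper_pairs m \<union> (\<lambda>c. (c, Suc m)) ` {1..m}"
    by (auto simp: upper_pairs_def le_Suc_eq)
  moreover have "upper_pairs m \<inter> (\<lambda>c. (c, Suc m)) ` {1..m} = {}"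
    by (auto simp: upper_pairs_def)
  ultimately have "(\<Sum>(c, c')\<in>upper_pairs (Suc m). w (f c) (f c')) =
      (\<Sum>(c, c')\<in>upper_pairs m. w (f c) (f c')) + (\<Sum>c=1..m. w (f c) (f (Suc m)))"
    by (simp add: sum.union_disjoint sum.reindex inj_on_def)
  moreover have "(\<Sum>c\<leftarrow>[1..<Suc m]. w (f c) (f (Suc m))) = (\<Sum>c=1..m. w (f c) (f (Suc m)))"
    by (simp only: interv_sum_list_conv_sum_set_nat set_upt atLeastLessThanSuc_atLeastAtMost)
  moreover have "map f [1..<Suc (Suc m)] = map f [1..<Suc m] @ [f (Suc m)]" by simp
  ultimately show ?case using Suc by (simp only: pair_sum_append) (simp add: o_def)
qed

lemma occ_map_upt: "occ i (map f [1..<Suc m]) = card {c \<in> {1..m}. i \<in> f c}"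
proof (induction m)
  case (Suc m)
  have "{c \<in> {1..Suc m}. i \<in> f c} = {c \<in> {1..m}. i \<in> f c} \<union> (if i \<in> f (Suc m) then {Suc m} else {})"
    by (auto simp: le_Suc_eq)
  hence "card {c \<in> {1..Suc m}. i \<in> f c} = card {c \<in> {1..m}. i \<in> f c} + of_bool (i \<in> f (Suc m))"
    by (subst (asm) if_distrib) (simp add: card_insert_if)
  thus ?case using Suc by (simp add: occ_def)
qed simp

lemma card_square:
  fixes S :: "nat set"
  assumes "finite S"
  shows "(card S)\<^sup>2 = card S + 2 * card {(c, c') \<in> S \<times> S. c < c'}"
proof -
  let ?L = "{(c, c') \<in> S \<times> S. c < c'}" and ?D = "(\<lambda>c. (c, c)) ` S"
  have fin: "finite ?L" by (rule finite_subset[of _ "S \<times> S"]) (use assms in auto)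
  have "S \<times> S = ?L \<union> prod.swap ` ?L \<union> ?D"
    by (auto simp: image_iff)
  hence "card (S \<times> S) = card (?L \<union> prod.swap ` ?L \<union> ?D)" by (rule arg_cong)
  also have "card (?L \<union> prod.swap ` ?L \<union> ?D) = card ?L + card (prod.swap ` ?L) + card ?D"
    using fin assms by (subst card_Un_disjoint; (subst card_Un_disjoint)?; auto)
  also have "card (prod.swap ` ?L) = card ?L" by (rule card_image) (auto simp: inj_on_def)
  also have "card ?D = card S" by (rule card_image) (auto simp: inj_on_def)
  finally show ?thesis by (simp add: power2_eq_square card_cartesian_product)
qed

lemma sum_card_swap:
  assumes "finite X" "finite C"
  shows "(\<Sum>x\<in>X. card {c \<in> C. R x c}) = (\<Sum>c\<in>C. card {x \<in> X. R x c})"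
proof -
  have 1: "card {c \<in> C. R x c} = (\<Sum>c\<in>C. if R x c then 1 else 0)" for x
    using sum.inter_filter[OF assms(2), of "\<lambda>_. 1 :: nat" "R x"] by simp
  have 2: "card {x \<in> X. R x c} = (\<Sum>x\<in>X. if R x c then 1 else 0)" for c
    using sum.inter_filter[OF assms(1), of "\<lambda>_. 1 :: nat" "\<lambda>x. R x c"] by simp
  show ?thesis unfolding 1 2 by (rule sum.swap)
qed

text \<open>The square of the number of columns containing \<open>x\<close> counts ordered pairs of
  such columns. It is applied twice: to the rows of the diagram and to the letters of the
  filling.\<close>

lemma sum_squares_incidence:
  assumes "finite X"
  shows "(\<Sum>x\<in>X. (card {c \<in> {1..m}. Q x c})\<^sup>2) = (\<Sum>c=1..m. card {x \<in> X. Q x c}) +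
    2 * (\<Sum>(c, c')\<in>upper_pairs m. card {x \<in> X. Q x c \<and> Q x c'})"
proof -
  let ?S = "\<lambda>x. {c \<in> {1..m}. Q x c}"
  have "{(c, c') \<in> ?S x \<times> ?S x. c < c'} = {p \<in> upper_pairs m. Q x (fst p) \<and> Q x (snd p)}" for x
    by (auto simp: upper_pairs_def)
  hence "(\<Sum>x\<in>X. (card (?S x))\<^sup>2) =
      (\<Sum>x\<in>X. card (?S x) + 2 * card {p \<in> upper_pairs m. Q x (fst p) \<and> Q x (snd p)})"
    by (subst card_square) simp_all
  also have "\<dots> = (\<Sum>x\<in>X. card (?S x)) + 2 * (\<Sum>x\<in>X. card {p \<in> upper_pairs m. Q x (fst p) \<and> Q x (snd p)})"
    by (simp add: sum.distrib sum_distrib_left)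
  also have "(\<Sum>x\<in>X. card (?S x)) = (\<Sum>c=1..m. card {x \<in> X. Q x c})"
    using assms by (intro sum_card_swap) auto
  also have "(\<Sum>x\<in>X. card {p \<in> upper_pairs m. Q x (fst p) \<and> Q x (snd p)}) =
      (\<Sum>p\<in>upper_pairs m. card {x \<in> X. Q x (fst p) \<and> Q x (snd p)})"
    using assms by (intro sum_card_swap) auto
  finally show ?thesis by (simp add: case_prod_unfold)
qed

text \<open>Translates equality of ranks into comparisons with two consecutive entries of the left
  column. For an entry in row \<open>r\<close> of the right column, these are exactly the entries
  that attacking pairs compare it with.\<close>

lemma rank_in_column:
  fixes a :: "nat \<Rightarrow> nat"
  assumes "strict_mono_on {1..p} a" "1 \<le> r" "r \<le> p"
  shows "card (a ` {1..p} \<inter> {..<x}) = r - 1 \<and> x \<notin> a ` {1..p} \<longleftrightarrow> x < a r \<and> (r = 1 \<or> a (r - 1) < x)"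
proof -
  have less: "a s < a t" if "s \<in> {1..p}" "t \<in> {1..p}" "s < t" for s t
    using assms(1) that by (auto simp: strict_mono_on_def)
  have le: "a s \<le> a t" if "s \<in> {1..p}" "t \<in> {1..p}" "s \<le> t" for s t
    using less[OF that(1,2)] that(3) by (cases "s = t") auto
  have inj: "inj_on a {1..p}" using assms(1) by (rule strict_mono_on_imp_inj_on)
  define T where "T = {s \<in> {1..p}. a s < x}"
  have "a ` {1..p} \<inter> {..<x} = a ` T" by (auto simp: T_def)
  moreover have "card (a ` T) = card T"
    by (rule card_image) (rule inj_on_subset[OF inj], auto simp: T_def)
  ultimately have card: "card (a ` {1..p} \<inter> {..<x}) = card T" by simp
  have fin: "finite T" by (simp add: T_def)
  show ?thesis
    unfolding card
  proof
    assume L: "card T = r - 1 \<and> x \<notin> a ` {1..p}"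
    have "x < a r"
    proof (rule ccontr)
      assume "\<not> x < a r"
      moreover have "x \<noteq> a r" using L assms(2,3) by auto
      ultimately have "a r < x" by simp
      have "{1..r} \<subseteq> T"
      proof
        fix s assume s: "s \<in> {1..r}"
        hence "a s \<le> a r" using assms(3) by (intro le) auto
        thus "s \<in> T" using s assms(3) \<open>a r < x\<close> by (simp add: T_def)
      qed
      hence "r \<le> card T" using card_mono[OF fin, of "{1..r}"] by simp
      thus False using L assms(2) by linarith
    qed
    moreover have "r = 1 \<or> a (r - 1) < x"
    proof (rule ccontr)
      assume N: "\<not> (r = 1 \<or> a (r - 1) < x)"
      have "T \<subseteq> {1..<r - 1}"
      proof
        fix s assume s: "s \<in> T"
        hence "a s < a (r - 1)" and sp: "s \<in> {1..p}" using N by (auto simp: T_def)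
        have "\<not> r - 1 \<le> s"
        proof
          assume "r - 1 \<le> s"
          hence "a (r - 1) \<le> a s" using N assms(2,3) sp by (intro le) auto
          thus False using \<open>a s < a (r - 1)\<close> by simp
        qed
        thus "s \<in> {1..<r - 1}" using s by (simp add: T_def)
      qed
      hence "card T \<le> r - 2" using card_mono[of "{1..<r - 1}" T] by simp
      thus False using L N assms(2) by linarith
    qed
    ultimately show "x < a r \<and> (r = 1 \<or> a (r - 1) < x)" by simp
  next
    assume R: "x < a r \<and> (r = 1 \<or> a (r - 1) < x)"
    have lo: "a s < x" if "s \<in> {1..p}" "s < r" for s
    proof (cases "s = r - 1")
      case True
      thus ?thesis using R that by auto
    next
      case False
      hence "a s < a (r - 1)" using that assms(3) by (intro less) auto
      thus ?thesis using R that by auto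
    qed
    have hi: "x < a s" if "s \<in> {1..p}" "r \<le> s" for s
    proof (cases "s = r")
      case False
      hence "a r < a s" using that assms(2,3) by (intro less) auto
      thus ?thesis using R by simp
    qed (use R in simp)
    have "T = {1..<r}"
    proof (intro set_eqI iffI)
      fix s assume "s \<in> T"
      hence "s \<in> {1..p}" "\<not> x < a s" by (simp_all add: T_def)
      thus "s \<in> {1..<r}" using hi[of s] by (cases "r \<le> s") auto
    next
      fix s assume "s \<in> {1..<r}"
      thus "s \<in> T" using lo[of s] assms(3) by (simp add: T_def)
    qed
    moreover have "x \<notin> a ` {1..p}" using lo hi by (metis imageE less_irrefl not_le)
    ultimately show "card T = r - 1 \<and> x \<notin> a ` {1..p}" by simp
  qed
qed

text \<open>
  The attacking pairs between two columns, minus the \<open>q - 1\<close> contributions of the right column to the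
  arms of the left one, count the entries of the right column that interlace with the left one.
\<close>
lemma dcol_strict_mono:
  fixes a b :: "nat \<Rightarrow> nat"
  assumes a: "strict_mono_on {1..p} a" and b: "strict_mono_on {1..q} b" and "1 \<le> q" "q \<le> p"
  shows "card {r \<in> {1..q}. b r < a r} + card {r \<in> {2..q}. a (r - 1) < b r} + dcol (a ` {1..p}) (b ` {1..q}) =
    (q - 1) + card (b ` {1..q} - a ` {1..p})"
proof -
  let ?A = "a ` {1..p}" and ?B = "b ` {1..q}"
  let ?X = "{r \<in> {1..q}. b r < a r}" and ?Y = "{r \<in> {2..q}. a (r - 1) < b r}"
  let ?T = "{r \<in> {1..q}. b r < a r \<and> (r = 1 \<or> a (r - 1) < b r)}"
  let ?E = "{x \<in> ?B - ?A. card (?A \<inter> {..<x}) = card (?B \<inter> {..<x})}"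
  have inj: "inj_on b {1..q}" using b by (rule strict_mono_on_imp_inj_on)
  have rank: "card (?B \<inter> {..<b r}) = r - 1" if "r \<in> {1..q}" for r
  proof -
    have "?B \<inter> {..<b r} = b ` {1..<r}"
      using strict_mono_on_less[OF b] that by auto
    moreover have "card (b ` {1..<r}) = card {1..<r}"
      by (rule card_image) (rule inj_on_subset[OF inj], use that in auto)
    ultimately show ?thesis by simp
  qed
  \<comment> \<open>The letters of equal rank correspond to the rows whose entry interlaces with the
    left column.\<close>
  have "?E = b ` ?T"
  proof -
    have mem: "b r \<in> ?E \<longleftrightarrow> r \<in> ?T" if r: "r \<in> {1..q}" for r
    proof -
      have "b r \<in> ?B" using r by (rule imageI)
      hence "b r \<in> ?E \<longleftrightarrow> card (?A \<inter> {..<b r}) = r - 1 \<and> b r \<notin> ?A"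
        by (simp only: mem_Collect_eq Diff_iff rank[OF r] simp_thms conj_commute)
      also have "\<dots> \<longleftrightarrow> b r < a r \<and> (r = 1 \<or> a (r - 1) < b r)"
        using r assms(4) by (intro rank_in_column[OF a]) auto
      also have "\<dots> \<longleftrightarrow> r \<in> ?T" using r by simp
      finally show ?thesis .
    qed
    show ?thesis
    proof (intro subset_antisym subsetI)
      fix x assume x: "x \<in> ?E"
      hence "x \<in> ?B" by (simp only: mem_Collect_eq Diff_iff)
      then obtain r where r: "x = b r" "r \<in> {1..q}" by (rule imageE)
      have "b r \<in> ?E" using x by (simp only: r(1))
      with mem[OF r(2)] have "r \<in> ?T" by (rule iffD1)
      thus "x \<in> b ` ?T" unfolding r(1) by (rule imageI)
    next
      fix x assume "x \<in> b ` ?T"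
      then obtain r where r: "x = b r" "r \<in> ?T" by (rule imageE)
      hence "r \<in> {1..q}" by (simp only: mem_Collect_eq)
      from mem[OF this] r(2) show "x \<in> ?E" unfolding r(1) by (rule iffD2)
    qed
  qed
  moreover have "card (b ` ?T) = card ?T"
    by (rule card_image) (rule inj_on_subset[OF inj], auto)
  ultimately have E: "card ?E = card ?T" by simp
  have "card (?B - ?A) = dcol ?A ?B + card ?E"
  proof -
    have "card {x \<in> S. \<not> P x} + card {x \<in> S. P x} = card S" if "finite S" for S :: "nat set" and P
    proof -
      have "S = {x \<in> S. \<not> P x} \<union> {x \<in> S. P x}" by blast
      hence "card S = card ({x \<in> S. \<not> P x} \<union> {x \<in> S. P x})" by (rule arg_cong)
      also have "\<dots> = card {x \<in> S. \<not> P x} + card {x \<in> S. P x}"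
        using that by (intro card_Un_disjoint) auto
      finally show ?thesis ..
    qed
    from this[of "?B - ?A"] show ?thesis by (simp add: dcol_def)
  qed
  \<comment> \<open>Inclusion and exclusion: the two sets cover all rows, since
    \<open>\<not> b r < a r\<close> gives \<open>a (r - 1) < a r \<le> b r\<close>, and their
    intersection is the set of interlacing rows. Row 1 has no row above it and is adjoined to
    \<open>?Y\<close> by hand; this is the one subtracted in \<open>q - 1\<close>.\<close>
  moreover have "card ?X + card (insert 1 ?Y) = card (?X \<union> insert 1 ?Y) + card (?X \<inter> insert 1 ?Y)"
    by (rule card_Un_Int) auto
  moreover have "card (insert 1 ?Y) = Suc (card ?Y)" by (subst card_insert_disjoint) auto
  moreover have "?X \<union> insert 1 ?Y = {1..q}"
  proof -
    have "r \<in> ?X \<union> insert 1 ?Y" if "r \<in> {1..q}" for r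
    proof (cases "r = 1 \<or> b r < a r")
      case False
      hence "a (r - 1) < a r" using that assms(4) by (intro strict_mono_onD[OF a]) auto
      thus ?thesis using False that by auto
    qed (use that in auto)
    hence "{1..q} \<subseteq> ?X \<union> insert 1 ?Y" by (rule subsetI)
    moreover have "?X \<union> insert 1 ?Y \<subseteq> {1..q}" using assms(3) by auto
    ultimately show ?thesis by (rule subset_antisym[rotated])
  qed
  moreover have "?X \<inter> insert 1 ?Y = ?T" using assms(3) by auto
  ultimately show ?thesis using E assms(3) by simp
qed

section \<open>Diagrams with fewer than n rows\<close>

locale shape =
  fixes n :: nat and \<mu> :: "nat \<Rightarrow> nat"
  assumes n_pos: "0 < n"
    and rows_antimono: "1 \<le> i \<Longrightarrow> \<mu> (Suc i) \<le> \<mu> i"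
    and rows_zero: "n \<le> i \<Longrightarrow> \<mu> i = 0"
begin

lemma rows_le:
  assumes "1 \<le> i" "i \<le> j"
  shows "\<mu> j \<le> \<mu> i"
  using assms(2)
proof (induction rule: dec_induct)
  case (step j)
  thus ?case using rows_antimono[of j] assms(1) by simp
qed simp

text \<open>Since the rows decrease in length, the cells of a column form an initial segment, so its
  cardinality \<open>height\<close> locates them.\<close>

lemma mem_dg_iff: "(r, c) \<in> dg \<mu> \<longleftrightarrow> 1 \<le> c \<and> 1 \<le> r \<and> r \<le> height \<mu> c"
proof (cases "1 \<le> c")
  case True
  let ?R = "{r. (r, c) \<in> dg \<mu>}"
  have sub: "?R \<subseteq> {1..<n}" using True rows_zero by (fastforce simp: dg_def not_le[symmetric])
  have fin: "finite ?R" using sub finite_subset by blast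
  have down: "s \<in> ?R" if "r \<in> ?R" "1 \<le> s" "s \<le> r" for r s
    using that rows_le[of s r] by (simp add: dg_def)
  have "?R = {1..card ?R}"
  proof (cases "?R = {}")
    case False
    let ?k = "Max ?R"
    have k: "?k \<in> ?R" using fin False by (rule Max_in)
    have "?R = {1..?k}"
    proof (intro subset_antisym subsetI)
      fix r assume "r \<in> ?R"
      thus "r \<in> {1..?k}" using Max_ge[OF fin] by (simp add: dg_def)
    next
      fix r assume "r \<in> {1..?k}"
      thus "r \<in> ?R" by (intro down[OF k]) simp_all
    qed
    thus ?thesis by (metis card_atLeastAtMost diff_Suc_1)
  qed simp
  hence "r \<in> ?R \<longleftrightarrow> r \<in> {1..height \<mu> c}" unfolding height_def by (rule arg_cong)
  thus ?thesis using True by simp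
qed (simp add: dg_def)

lemma height_antimono: "1 \<le> c \<Longrightarrow> c \<le> d \<Longrightarrow> height \<mu> d \<le> height \<mu> c"
  using mem_dg_iff[of "height \<mu> d" d] mem_dg_iff[of "height \<mu> d" c]
  by (cases "height \<mu> d") (auto simp: dg_def)

lemma height_less_n:
  assumes "1 \<le> c"
  shows "height \<mu> c < n"
proof (rule ccontr)
  assume h: "\<not> height \<mu> c < n"
  hence "(height \<mu> c, c) \<in> dg \<mu>" using assms n_pos unfolding mem_dg_iff by simp
  thus False using assms h rows_zero[of "height \<mu> c"] by (simp add: dg_def)
qed

lemma height_pos: "1 \<le> c \<Longrightarrow> c \<le> \<mu> 1 \<Longrightarrow> 1 \<le> height \<mu> c"
  using mem_dg_iff[of 1 c] by (simp add: dg_def)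

lemma mem_dg_col: "(r, c) \<in> dg \<mu> \<Longrightarrow> c \<in> {1..\<mu> 1}"
  using rows_le[of 1 r] by (simp add: dg_def)

lemma dg_eq_Sigma: "dg \<mu> = (\<lambda>(c, r). (r, c)) ` (SIGMA c:{1..\<mu> 1}. {1..height \<mu> c})"
  using mem_dg_iff mem_dg_col by (force simp: image_iff)

lemma finite_cells: "finite (dg \<mu>)"
  unfolding dg_eq_Sigma by simp

lemma sum_dg: "(\<Sum>u\<in>dg \<mu>. f u) = (\<Sum>c=1..\<mu> 1. \<Sum>r=1..height \<mu> c. f (r, c))"
proof -
  have "inj_on (\<lambda>(c, r). (r, c)) (SIGMA c:{1..\<mu> 1}. {1..height \<mu> c})"
    by (auto simp: inj_on_def)
  thus ?thesis
    unfolding dg_eq_Sigma by (simp add: sum.reindex sum.Sigma case_prod_unfold del: One_nat_def)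
qed

text \<open>Both sides count the cells in the first \<open>k\<close> rows, once by columns and once
  by rows.\<close>

lemma sum_min_heights:
  "(\<Sum>h\<leftarrow>heights \<mu>. min h k) = (\<Sum>r=1..k. \<mu> r)"
proof -
  have "(\<Sum>h\<leftarrow>heights \<mu>. min h k) = (\<Sum>c=1..\<mu> 1. min (height \<mu> c) k)"
    unfolding heights_def map_map o_def
    by (simp only: interv_sum_list_conv_sum_set_nat set_upt atLeastLessThanSuc_atLeastAtMost)
  also have "\<dots> = (\<Sum>c=1..\<mu> 1. card {r \<in> {1..k}. (r, c) \<in> dg \<mu>})"
  proof (rule sum.cong)
    fix c assume "c \<in> {1..\<mu> 1}"
    hence "{r \<in> {1..k}. (r, c) \<in> dg \<mu>} = {1..min (height \<mu> c) k}"
      by (auto simp: mem_dg_iff)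
    thus "min (height \<mu> c) k = card {r \<in> {1..k}. (r, c) \<in> dg \<mu>}" by simp
  qed simp
  also have "\<dots> = (\<Sum>r=1..k. card {c \<in> {1..\<mu> 1}. (r, c) \<in> dg \<mu>})"
    by (rule sum_card_swap[symmetric]) simp_all
  also have "\<dots> = (\<Sum>r=1..k. \<mu> r)"
  proof (rule sum.cong)
    fix r assume r: "r \<in> {1..k}"
    hence "{c \<in> {1..\<mu> 1}. (r, c) \<in> dg \<mu>} = {1..\<mu> r}"
      using rows_le[of 1 r] by (auto simp: dg_def)
    thus "card {c \<in> {1..\<mu> 1}. (r, c) \<in> dg \<mu>} = \<mu> r" by simp
  qed simp
  finally show ?thesis .
qed

lemma sum_heights: "(\<Sum>c=1..\<mu> 1. height \<mu> c) = vsum n \<mu>"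
proof -
  have "(\<Sum>c=1..\<mu> 1. height \<mu> c) = (\<Sum>c=1..\<mu> 1. min (height \<mu> c) n)"
  proof (rule sum.cong)
    fix c assume "c \<in> {1..\<mu> 1}"
    hence "height \<mu> c < n" by (intro height_less_n) simp
    thus "height \<mu> c = min (height \<mu> c) n" by simp
  qed simp
  also have "\<dots> = (\<Sum>h\<leftarrow>heights \<mu>. min h n)"
    unfolding heights_def map_map o_def
    by (simp only: interv_sum_list_conv_sum_set_nat set_upt atLeastLessThanSuc_atLeastAtMost)
  finally show ?thesis by (simp only: sum_min_heights vsum_def)
qed

text \<open>Two columns \<open>c < c'\<close> of a diagram have exactly
  \<open>height \<mu> c'\<close> rows in common.\<close>

lemma sum_sq_rows:
  "(\<Sum>r=1..n. (\<mu> r)\<^sup>2) = vsum n \<mu> + 2 * (\<Sum>(c, c')\<in>upper_pairs (\<mu> 1). height \<mu> c')"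
proof -
  have "(\<Sum>r=1..n. (\<mu> r)\<^sup>2) = (\<Sum>r\<in>{1..n}. (card {c \<in> {1..\<mu> 1}. (r, c) \<in> dg \<mu>})\<^sup>2)"
  proof (rule sum.cong)
    fix r assume r: "r \<in> {1..n}"
    hence "{c \<in> {1..\<mu> 1}. (r, c) \<in> dg \<mu>} = {1..\<mu> r}"
      using rows_le[of 1 r] by (auto simp: dg_def)
    thus "(\<mu> r)\<^sup>2 = (card {c \<in> {1..\<mu> 1}. (r, c) \<in> dg \<mu>})\<^sup>2" by simp
  qed simp
  also have "\<dots> = (\<Sum>c=1..\<mu> 1. card {r \<in> {1..n}. (r, c) \<in> dg \<mu>}) + 2 * (\<Sum>(c, c')\<in>upper_pairs (\<mu> 1).
      card {r \<in> {1..n}. (r, c) \<in> dg \<mu> \<and> (r, c') \<in> dg \<mu>})"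
    by (rule sum_squares_incidence) simp
  also have "(\<Sum>c=1..\<mu> 1. card {r \<in> {1..n}. (r, c) \<in> dg \<mu>}) = vsum n \<mu>"
    unfolding sum_heights[symmetric]
  proof (rule sum.cong)
    fix c assume "c \<in> {1..\<mu> 1}"
    hence "{r \<in> {1..n}. (r, c) \<in> dg \<mu>} = {1..height \<mu> c}"
      using height_less_n[of c] by (auto simp: mem_dg_iff)
    thus "card {r \<in> {1..n}. (r, c) \<in> dg \<mu>} = height \<mu> c" by simp
  qed simp
  also have "(\<Sum>(c, c')\<in>upper_pairs (\<mu> 1). card {r \<in> {1..n}. (r, c) \<in> dg \<mu> \<and> (r, c') \<in> dg \<mu>}) =
      (\<Sum>(c, c')\<in>upper_pairs (\<mu> 1). height \<mu> c')"
  proof (rule sum.cong, safe)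
    fix c c' assume "(c, c') \<in> upper_pairs (\<mu> 1)"
    hence "{r \<in> {1..n}. (r, c) \<in> dg \<mu> \<and> (r, c') \<in> dg \<mu>} = {1..height \<mu> c'}"
      using height_less_n[of c'] height_antimono[of c c'] by (auto simp: mem_dg_iff upper_pairs_def)
    thus "card {r \<in> {1..n}. (r, c) \<in> dg \<mu> \<and> (r, c') \<in> dg \<mu>} = height \<mu> c'" by simp
  qed
  finally show ?thesis .
qed

section \<open>Statistics of a column strict filling\<close>

context
  fixes F assumes F: "F \<in> CSF n \<mu>"
begin

lemma CSF_range: "(r, c) \<in> dg \<mu> \<Longrightarrow> F (r, c) \<in> {1..n}"
  using F by (auto simp: CSF_def)

lemma CSF_strict_mono: "1 \<le> c \<Longrightarrow> strict_mono_on {1..height \<mu> c} (\<lambda>r. F (r, c))"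
  using F by (auto simp: CSF_def strict_mono_on_def mem_dg_iff)

lemma card_column: "1 \<le> c \<Longrightarrow> card (col_set \<mu> F c) = height \<mu> c"
  unfolding col_set_def
  using card_image[OF strict_mono_on_imp_inj_on[OF CSF_strict_mono[of c]]] by simp

lemma column_subset: "1 \<le> c \<Longrightarrow> col_set \<mu> F c \<subseteq> {1..n}"
  using CSF_range by (auto simp: col_set_def mem_dg_iff)

lemma finite_column: "finite (col_set \<mu> F c)"
  by (simp add: col_set_def)

lemma columns_in_fillings: "col_sets \<mu> F \<in> fillings n (heights \<mu>)"
  using card_column column_subset by (auto simp: fillings_def col_sets_def heights_def)

lemma Des_eq: "Des \<mu> F = {(r, c) \<in> dg \<mu>. 2 \<le> r}"
proof -
  have "F (r - 1, c) < F (r, c)" if "(r, c) \<in> dg \<mu>" "2 \<le> r" for r c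
    using that by (intro strict_mono_onD[OF CSF_strict_mono[of c]]) (auto simp: mem_dg_iff)
  thus ?thesis by (auto simp: Des_def)
qed

text \<open>By \<open>Des_eq\<close> all cells below the first row are descents. A descent with a
  cell of its arm is a pair of columns together with a row between 2 and the height of the right
  one.\<close>

lemma sum_arm: "(\<Sum>u\<in>Des \<mu> F. arm \<mu> u) = (\<Sum>(c, c')\<in>upper_pairs (\<mu> 1). height \<mu> c' - 1)"
proof -
  have fin: "finite (Des \<mu> F)" "finite {v \<in> dg \<mu>. P v}" for P
    by (rule finite_subset[OF _ finite_cells], auto simp: Des_eq)+
  have "(\<Sum>u\<in>Des \<mu> F. arm \<mu> u) = card (SIGMA u:Des \<mu> F. {v \<in> dg \<mu>. fst v = fst u \<and> snd v > snd u})"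
    using fin by (simp add: arm_def)
  also have "\<dots> = card (SIGMA p:upper_pairs (\<mu> 1). {2..height \<mu> (snd p)})"
  proof (rule bij_betw_same_card, rule bij_betw_byWitness)
    show "(\<lambda>((r, c), (_, c')). ((c, c'), r)) ` (SIGMA u:Des \<mu> F. {v \<in> dg \<mu>. fst v = fst u \<and> snd v > snd u})
        \<subseteq> (SIGMA p:upper_pairs (\<mu> 1). {2..height \<mu> (snd p)})"
    proof (rule image_subsetI)
      fix q assume "q \<in> (SIGMA u:Des \<mu> F. {v \<in> dg \<mu>. fst v = fst u \<and> snd v > snd u})"
      moreover obtain r c r' c' where q: "q = ((r, c), (r', c'))" by (metis surj_pair)
      ultimately have dg: "(r, c) \<in> dg \<mu>" "(r', c') \<in> dg \<mu>" and "2 \<le> r" "r' = r" "c < c'"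
        unfolding Des_eq by auto
      thus "(\<lambda>((r, c), (_, c')). ((c, c'), r)) q \<in> (SIGMA p:upper_pairs (\<mu> 1). {2..height \<mu> (snd p)})"
        using mem_dg_col[OF dg(1)] mem_dg_col[OF dg(2)] unfolding q by (simp add: upper_pairs_def mem_dg_iff)
    qed
    show "(\<lambda>((c, c'), r). ((r, c), (r, c'))) ` (SIGMA p:upper_pairs (\<mu> 1). {2..height \<mu> (snd p)})
        \<subseteq> (SIGMA u:Des \<mu> F. {v \<in> dg \<mu>. fst v = fst u \<and> snd v > snd u})"
      using height_antimono by (auto simp: Des_eq upper_pairs_def mem_dg_iff intro: order_trans)
  qed auto
  also have "\<dots> = (\<Sum>(c, c')\<in>upper_pairs (\<mu> 1). height \<mu> c' - 1)"
    by (simp add: case_prod_unfold)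
  finally show ?thesis .
qed

text \<open>Inversions are grouped by the two columns involved: those within one row give the first
  summand, those between consecutive rows the second.\<close>

lemma card_Inv:
  "card (Inv \<mu> F) = (\<Sum>(c, c')\<in>upper_pairs (\<mu> 1).
     card {r \<in> {1..height \<mu> c'}. F (r, c') < F (r, c)} +
     card {r \<in> {2..height \<mu> c'}. F (r - 1, c) < F (r, c')})"
proof -
  let ?P = "upper_pairs (\<mu> 1)"
  let ?X = "\<lambda>p. {r \<in> {1..height \<mu> (snd p)}. F (r, snd p) < F (r, fst p)}"
  let ?Y = "\<lambda>p. {r \<in> {2..height \<mu> (snd p)}. F (r - 1, fst p) < F (r, snd p)}"
  let ?f = "\<lambda>((c, c'), r). ((r, c), (r, c'))" and ?g = "\<lambda>((c, c'), r). ((r, c'), (r - 1, c))"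
  have dgI: "(r, c) \<in> dg \<mu>" if "(c, c') \<in> ?P" "1 \<le> r" "r \<le> height \<mu> c'" for r c c'
    using that height_antimono[of c c'] by (auto simp: mem_dg_iff upper_pairs_def)
  have dgI': "(r, c') \<in> dg \<mu>" if "(c, c') \<in> ?P" "1 \<le> r" "r \<le> height \<mu> c'" for r c c'
    using that by (auto simp: mem_dg_iff upper_pairs_def)
  have "Inv \<mu> F = ?f ` Sigma ?P ?X \<union> ?g ` Sigma ?P ?Y"
  proof (intro subset_antisym subsetI)
    fix w assume w: "w \<in> Inv \<mu> F"
    obtain r c r' c' where w_eq: "w = ((r, c), (r', c'))" by (metis surj_pair)
    have dg: "(r, c) \<in> dg \<mu>" "(r', c') \<in> dg \<mu>" and gt: "F (r', c') < F (r, c)"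
      and att: "r = r' \<and> c < c' \<or> r = Suc r' \<and> c' < c"
      using w by (auto simp: Inv_def Inv_attacks_def w_eq)
    from att show "w \<in> ?f ` Sigma ?P ?X \<union> ?g ` Sigma ?P ?Y"
    proof
      assume A: "r = r' \<and> c < c'"
      hence "((c, c'), r) \<in> Sigma ?P ?X"
        using dg gt mem_dg_col[OF dg(1)] mem_dg_col[OF dg(2)] by (auto simp: upper_pairs_def mem_dg_iff)
      moreover have "w = ?f ((c, c'), r)" using A w_eq by simp
      ultimately show ?thesis by blast
    next
      assume A: "r = Suc r' \<and> c' < c"
      hence "((c', c), r) \<in> Sigma ?P ?Y"
        using dg gt mem_dg_col[OF dg(1)] mem_dg_col[OF dg(2)] by (auto simp: upper_pairs_def mem_dg_iff)
      moreover have "w = ?g ((c', c), r)" using A w_eq by simp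
      ultimately show ?thesis by blast
    qed
  next
    fix w assume "w \<in> ?f ` Sigma ?P ?X \<union> ?g ` Sigma ?P ?Y"
    thus "w \<in> Inv \<mu> F"
    proof
      assume "w \<in> ?f ` Sigma ?P ?X"
      then obtain c c' r where w: "w = ((r, c), (r, c'))" "(c, c') \<in> ?P" "r \<in> ?X (c, c')" by auto
      thus ?thesis using dgI[of c c' r] dgI'[of c c' r]
        by (auto simp: Inv_def Inv_attacks_def upper_pairs_def)
    next
      assume "w \<in> ?g ` Sigma ?P ?Y"
      then obtain c c' r where w: "w = ((r, c'), (r - 1, c))" "(c, c') \<in> ?P" "r \<in> ?Y (c, c')" by auto
      thus ?thesis using dgI[of c c' "r - 1"] dgI'[of c c' r]
        by (auto simp: Inv_def Inv_attacks_def upper_pairs_def)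
    qed
  qed
  moreover have "card (?f ` Sigma ?P ?X \<union> ?g ` Sigma ?P ?Y) = card (?f ` Sigma ?P ?X) + card (?g ` Sigma ?P ?Y)"
    by (intro card_Un_disjoint finite_imageI finite_SigmaI finite_upper_pairs) (auto simp: upper_pairs_def)
  moreover have "card (?f ` Sigma ?P ?X) = (\<Sum>p\<in>?P. card (?X p))"
    by (subst card_image) (auto simp: inj_on_def)
  moreover have "card (?g ` Sigma ?P ?Y) = (\<Sum>p\<in>?P. card (?Y p))"
    by (subst card_image) (auto simp: inj_on_def)
  ultimately show ?thesis by (simp add: sum.distrib case_prod_unfold)
qed

text \<open>The identity \<open>dcol_strict_mono\<close> summed over all pairs of columns; the terms
  \<open>q - 1\<close> add up to the arms of the descents and cancel.\<close>

lemma inv_stat_eq: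
  "inv_stat \<mu> F + int (pair_sum dcol (col_sets \<mu> F)) =
     int (\<Sum>(c, c')\<in>upper_pairs (\<mu> 1). card (col_set \<mu> F c' - col_set \<mu> F c))"
proof -
  let ?P = "upper_pairs (\<mu> 1)"
  have "card {r \<in> {1..height \<mu> c'}. F (r, c') < F (r, c)} + card {r \<in> {2..height \<mu> c'}. F (r - 1, c) < F (r, c')}
      + dcol (col_set \<mu> F c) (col_set \<mu> F c') = (height \<mu> c' - 1) + card (col_set \<mu> F c' - col_set \<mu> F c)"
    if "(c, c') \<in> ?P" for c c'
  proof -
    have c: "1 \<le> c" "1 \<le> c'" "c \<le> c'" "c' \<le> \<mu> 1" using that by (auto simp: upper_pairs_def)
    show ?thesis
      unfolding col_set_def
      by (rule dcol_strict_mono[OF CSF_strict_mono[OF c(1)] CSF_strict_mono[OF c(2)]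
            height_pos[OF c(2,4)] height_antimono[OF c(1,3)]])
  qed
  hence "(\<Sum>(c, c')\<in>?P. card {r \<in> {1..height \<mu> c'}. F (r, c') < F (r, c)} +
        card {r \<in> {2..height \<mu> c'}. F (r - 1, c) < F (r, c')} + dcol (col_set \<mu> F c) (col_set \<mu> F c')) =
      (\<Sum>(c, c')\<in>?P. (height \<mu> c' - 1) + card (col_set \<mu> F c' - col_set \<mu> F c))"
    by (intro sum.cong) auto
  hence "card (Inv \<mu> F) + pair_sum dcol (col_sets \<mu> F) =
      (\<Sum>u\<in>Des \<mu> F. arm \<mu> u) + (\<Sum>(c, c')\<in>?P. card (col_set \<mu> F c' - col_set \<mu> F c))"
    unfolding card_Inv sum_arm col_sets_def pair_sum_map_upt
    by (simp add: case_prod_unfold sum.distrib)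
  hence "int (card (Inv \<mu> F)) + int (pair_sum dcol (col_sets \<mu> F)) =
      int (\<Sum>u\<in>Des \<mu> F. arm \<mu> u) + int (\<Sum>(c, c')\<in>?P. card (col_set \<mu> F c' - col_set \<mu> F c))"
    by (metis of_nat_add)
  thus ?thesis by (simp add: inv_stat_def)
qed

lemma occ_columns: "occ i (col_sets \<mu> F) = card {c \<in> {1..\<mu> 1}. i \<in> col_set \<mu> F c}"
  unfolding col_sets_def by (rule occ_map_upt)

lemma sum_occ: "(\<Sum>i=1..n. occ i (col_sets \<mu> F)) = vsum n \<mu>"
proof -
  have "(\<Sum>i=1..n. occ i (col_sets \<mu> F)) = (\<Sum>c=1..\<mu> 1. card {i \<in> {1..n}. i \<in> col_set \<mu> F c})"
    unfolding occ_columns by (rule sum_card_swap) simp_all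
  also have "\<dots> = (\<Sum>c=1..\<mu> 1. height \<mu> c)"
  proof (rule sum.cong)
    fix c assume "c \<in> {1..\<mu> 1}"
    hence "{i \<in> {1..n}. i \<in> col_set \<mu> F c} = col_set \<mu> F c" "card (col_set \<mu> F c) = height \<mu> c"
      using column_subset[of c] card_column[of c] by auto
    thus "card {i \<in> {1..n}. i \<in> col_set \<mu> F c} = height \<mu> c" by simp
  qed simp
  finally show ?thesis by (simp only: sum_heights)
qed

lemma sum_sq_occ:
  "(\<Sum>i=1..n. (occ i (col_sets \<mu> F))\<^sup>2) = vsum n \<mu> +
     2 * (\<Sum>(c, c')\<in>upper_pairs (\<mu> 1). card (col_set \<mu> F c \<inter> col_set \<mu> F c'))"
proof -
  have "(\<Sum>i=1..n. (occ i (col_sets \<mu> F))\<^sup>2) = (\<Sum>c=1..\<mu> 1. card {i \<in> {1..n}. i \<in> col_set \<mu> F c}) +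
      2 * (\<Sum>(c, c')\<in>upper_pairs (\<mu> 1). card {i \<in> {1..n}. i \<in> col_set \<mu> F c \<and> i \<in> col_set \<mu> F c'})"
    unfolding occ_columns by (rule sum_squares_incidence) simp
  also have "(\<Sum>c=1..\<mu> 1. card {i \<in> {1..n}. i \<in> col_set \<mu> F c}) = vsum n \<mu>"
    unfolding sum_occ[symmetric] occ_columns by (rule sum_card_swap) simp_all
  also have "(\<Sum>(c, c')\<in>upper_pairs (\<mu> 1). card {i \<in> {1..n}. i \<in> col_set \<mu> F c \<and> i \<in> col_set \<mu> F c'}) =
      (\<Sum>(c, c')\<in>upper_pairs (\<mu> 1). card (col_set \<mu> F c \<inter> col_set \<mu> F c'))"
  proof (rule sum.cong, safe)
    fix c c' assume "(c, c') \<in> upper_pairs (\<mu> 1)"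
    hence "{i \<in> {1..n}. i \<in> col_set \<mu> F c \<and> i \<in> col_set \<mu> F c'} = col_set \<mu> F c \<inter> col_set \<mu> F c'"
      using column_subset[of c] by (auto simp: upper_pairs_def)
    thus "card {i \<in> {1..n}. i \<in> col_set \<mu> F c \<and> i \<in> col_set \<mu> F c'} = card (col_set \<mu> F c \<inter> col_set \<mu> F c')"
      by simp
  qed
  finally show ?thesis .
qed

text \<open>By \<open>sum_sq_rows\<close> and \<open>sum_sq_occ\<close>, half the difference of the
  two sums of squares is the sum of \<open>card (A' - A)\<close> over pairs of a left column
  \<open>A\<close> and a right column \<open>A'\<close>. By \<open>inv_stat_eq\<close>, subtracting
  the inversion statistic from it leaves the sum of \<open>dcol\<close>.\<close>

lemma q_expo_eq:
  "q_expo n \<mu> F = sqnorm n (\<lambda>i. real (occ i (col_sets \<mu> F))) / 2 + real (pair_sum dcol (col_sets \<mu> F))"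
proof -
  let ?P = "upper_pairs (\<mu> 1)"
  have "(\<Sum>(c, c')\<in>?P. height \<mu> c') = (\<Sum>(c, c')\<in>?P. card (col_set \<mu> F c \<inter> col_set \<mu> F c')) +
      (\<Sum>(c, c')\<in>?P. card (col_set \<mu> F c' - col_set \<mu> F c))"
    unfolding case_prod_unfold sum.distrib[symmetric]
  proof (rule sum.cong[OF refl])
    fix p assume "p \<in> ?P"
    hence "height \<mu> (snd p) = card (col_set \<mu> F (snd p))" by (subst card_column) (auto simp: upper_pairs_def)
    also have "col_set \<mu> F (snd p) = (col_set \<mu> F (fst p) \<inter> col_set \<mu> F (snd p)) \<union> (col_set \<mu> F (snd p) - col_set \<mu> F (fst p))"
      by blast
    also have "card \<dots> = card (col_set \<mu> F (fst p) \<inter> col_set \<mu> F (snd p)) + card (col_set \<mu> F (snd p) - col_set \<mu> F (fst p))"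
      by (rule card_Un_disjoint) (auto simp: finite_column)
    finally show "height \<mu> (snd p) =
      card (col_set \<mu> F (fst p) \<inter> col_set \<mu> F (snd p)) + card (col_set \<mu> F (snd p) - col_set \<mu> F (fst p))" .
  qed
  hence "(\<Sum>r=1..n. (\<mu> r)\<^sup>2) = (\<Sum>i=1..n. (occ i (col_sets \<mu> F))\<^sup>2) +
      2 * (\<Sum>(c, c')\<in>?P. card (col_set \<mu> F c' - col_set \<mu> F c))"
    unfolding sum_sq_rows sum_sq_occ by simp
  hence "real (\<Sum>r=1..n. (\<mu> r)\<^sup>2) = real (\<Sum>i=1..n. (occ i (col_sets \<mu> F))\<^sup>2) +
      2 * real (\<Sum>(c, c')\<in>?P. card (col_set \<mu> F c' - col_set \<mu> F c))"
    by (metis of_nat_add of_nat_mult of_nat_numeral)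
  moreover have "real_of_int (inv_stat \<mu> F) + real (pair_sum dcol (col_sets \<mu> F)) =
      real (\<Sum>(c, c')\<in>?P. card (col_set \<mu> F c' - col_set \<mu> F c))"
    using arg_cong[OF inv_stat_eq, of real_of_int] by (simp only: of_int_add of_int_of_nat_eq)
  moreover have "vsum n (\<lambda>i. real (\<mu> i)) = vsum n (\<lambda>i. real (occ i (col_sets \<mu> F)))"
    using arg_cong[OF sum_occ, of real] by (simp add: vsum_def)
  ultimately show ?thesis
    unfolding q_expo_def sqnorm_def of_nat_sum of_nat_power by (simp add: field_simps)
qed

end

end

section \<open>Fillings correspond to lists of column sets\<close>

context shape
begin

lemma sorted_list_col_set:
  assumes "F \<in> CSF n \<mu>" "1 \<le> c"
  shows "sorted_list_of_set (col_set \<mu> F c) = map (\<lambda>r. F (r, c)) [1..<Suc (height \<mu> c)]"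
proof -
  have "sorted_wrt (<) (map (\<lambda>r. F (r, c)) [1..<Suc (height \<mu> c)])"
    unfolding sorted_wrt_map
    by (rule sorted_wrt_mono_rel[OF _ sorted_wrt_upt])
      (use strict_mono_onD[OF CSF_strict_mono[OF assms]] in auto)
  moreover have "set (map (\<lambda>r. F (r, c)) [1..<Suc (height \<mu> c)]) = col_set \<mu> F c"
    by (auto simp: col_set_def)
  moreover have "length (map (\<lambda>r. F (r, c)) [1..<Suc (height \<mu> c)]) = card (col_set \<mu> F c)"
    using card_column[OF assms] by simp
  ultimately show ?thesis
    using sorted_list_of_set_unique[OF finite_column[OF assms(1)]] by blast
qed

lemma fill_col_sets:
  assumes "F \<in> CSF n \<mu>"
  shows "fill \<mu> (col_sets \<mu> F) = F"
proof
  fix u :: cell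
  obtain r c where u: "u = (r, c)" by fastforce
  show "fill \<mu> (col_sets \<mu> F) u = F u"
  proof (cases "u \<in> dg \<mu>")
    case True
    hence r: "1 \<le> r" "r \<le> height \<mu> c" and c: "1 \<le> c" "c \<le> \<mu> 1"
      using mem_dg_iff[of r c] mem_dg_col[of r c] by (auto simp: u)
    have "col_sets \<mu> F ! (c - 1) = col_set \<mu> F c" using c by (simp add: col_sets_def del: upt_Suc)
    moreover have "[1..<Suc (height \<mu> c)] ! (r - 1) = r" using r by (subst nth_upt) auto
    ultimately show ?thesis
      using True r c by (simp add: fill_def u sorted_list_col_set[OF assms] del: upt_Suc)
  next
    case False
    hence "F u = undefined" using assms by (auto simp: CSF_def)
    thus ?thesis using False by (simp add: fill_def)
  qed
qed

lemma fill_fillings: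
  assumes "Cs \<in> fillings n (heights \<mu>)"
  shows "fill \<mu> Cs \<in> CSF n \<mu>" "col_sets \<mu> (fill \<mu> Cs) = Cs"
proof -
  have len: "length Cs = \<mu> 1"
  proof -
    have "map card Cs = heights \<mu>" using assms by (simp add: fillings_def)
    hence "length (map card Cs) = length (heights \<mu>)" by (rule arg_cong)
    thus ?thesis by (simp add: heights_def del: upt_Suc)
  qed
  have sub: "Cs ! (c - 1) \<subseteq> {1..n}" and card: "card (Cs ! (c - 1)) = height \<mu> c"
    if "c \<in> {1..\<mu> 1}" for c
  proof -
    have "c - 1 < length Cs" using that len by auto
    thus "Cs ! (c - 1) \<subseteq> {1..n}" using assms by (auto simp: fillings_def)
    have "map card Cs ! (c - 1) = heights \<mu> ! (c - 1)" using assms by (simp add: fillings_def)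
    moreover have "[1..<Suc (\<mu> 1)] ! (c - 1) = c" using that by (subst nth_upt) auto
    ultimately show "card (Cs ! (c - 1)) = height \<mu> c"
      using that len \<open>c - 1 < length Cs\<close> by (simp add: heights_def del: upt_Suc)
  qed
  define L where "L c = sorted_list_of_set (Cs ! (c - 1))" for c
  have L: "length (L c) = height \<mu> c" "set (L c) = Cs ! (c - 1)" "sorted_wrt (<) (L c)"
    if "c \<in> {1..\<mu> 1}" for c
    using card[OF that] finite_subset[OF sub[OF that]] by (simp_all add: L_def)
  have val: "fill \<mu> Cs (r, c) = L c ! (r - 1)" if "(r, c) \<in> dg \<mu>" for r c
    using that by (simp add: fill_def L_def)
  have "fill \<mu> Cs (r, c) \<in> {1..n}" if "(r, c) \<in> dg \<mu>" for r c
  proof -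
    have "L c ! (r - 1) \<in> set (L c)"
      using that L(1)[OF mem_dg_col[OF that]] by (intro nth_mem) (auto simp: mem_dg_iff)
    thus ?thesis using val[OF that] L(2)[OF mem_dg_col[OF that]] sub[OF mem_dg_col[OF that]] by auto
  qed
  moreover have "fill \<mu> Cs (r, c) < fill \<mu> Cs (r', c)"
    if "(r, c) \<in> dg \<mu>" "(r', c) \<in> dg \<mu>" "r < r'" for r r' c
  proof -
    have "L c ! (r - 1) < L c ! (r' - 1)"
      using that L(1)[OF mem_dg_col[OF that(1)]]
      by (intro sorted_wrt_nth_less[OF L(3)[OF mem_dg_col[OF that(1)]]]) (auto simp: mem_dg_iff)
    thus ?thesis using val that by simp
  qed
  moreover have "fill \<mu> Cs \<in> extensional (dg \<mu>)" by (simp add: fill_def)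
  ultimately show "fill \<mu> Cs \<in> CSF n \<mu>" by (auto simp: CSF_def PiE_def)
  show "col_sets \<mu> (fill \<mu> Cs) = Cs"
  proof (rule nth_equalityI)
    show "length (col_sets \<mu> (fill \<mu> Cs)) = length Cs" using len by (simp add: col_sets_def del: upt_Suc)
    fix i assume "i < length (col_sets \<mu> (fill \<mu> Cs))"
    hence i: "i < \<mu> 1" by (simp add: col_sets_def del: upt_Suc)
    hence c: "Suc i \<in> {1..\<mu> 1}" by simp
    have "col_sets \<mu> (fill \<mu> Cs) ! i = (\<lambda>r. fill \<mu> Cs (r, Suc i)) ` {1..height \<mu> (Suc i)}"
      using i by (simp add: col_sets_def col_set_def del: upt_Suc)
    also have "\<dots> = (\<lambda>r. L (Suc i) ! (r - 1)) ` {1..height \<mu> (Suc i)}"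
      by (intro image_cong refl val) (auto simp: mem_dg_iff)
    also have "\<dots> = (!) (L (Suc i)) ` (\<lambda>r. r - 1) ` {1..height \<mu> (Suc i)}"
      by (simp only: image_image)
    also have "(\<lambda>r. r - 1) ` {1..height \<mu> (Suc i)} = {..<height \<mu> (Suc i)}"
      by (force simp: image_iff)
    also have "(!) (L (Suc i)) ` {..<height \<mu> (Suc i)} = set (L (Suc i))"
      using L(1)[OF c] by (auto simp: set_conv_nth)
    also have "\<dots> = Cs ! i" using L(2)[OF c] by simp
    finally show "col_sets \<mu> (fill \<mu> Cs) ! i = Cs ! i" .
  qed
qed

lemma bij_betw_col_sets: "bij_betw (col_sets \<mu>) (CSF n \<mu>) (fillings n (heights \<mu>))"
  by (rule bij_betw_byWitness[where f' = "fill \<mu>"])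
    (auto simp: fill_col_sets fill_fillings columns_in_fillings)

lemma occurs_in_column_iff: "1 \<le> c \<Longrightarrow> occurs_in_column \<mu> F a c \<longleftrightarrow> a \<in> col_set \<mu> F c"
  by (auto simp: occurs_in_column_def col_set_def mem_dg_iff)

end

section \<open>Monomials and exponents in terms of column sets\<close>

definition weight :: "nat \<Rightarrow> nat \<Rightarrow> nat set list \<Rightarrow> (nat \<Rightarrow>\<^sub>0 int)" where
  "weight n s Cs = (\<Sum>i=1..n. Poly_Mapping.single i (int (occ i Cs) - int s))"

lemma lookup_weight: "Poly_Mapping.lookup (weight n s Cs) i = (if i \<in> {1..n} then int (occ i Cs) - int s else 0)"
  by (simp add: weight_def lookup_sum lookup_single when_def)

lemma xmon_add: "xmon (a + b) = xmon a * xmon b"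
  by (simp add: xmon_def mult_single)

lemma xmon_sum: "(\<Prod>x\<in>A. xmon (f x)) = xmon (\<Sum>x\<in>A. f x)"
  by (induction A rule: infinite_finite_induct) (simp_all add: xmon_add, simp_all add: xmon_def)

text \<open>On vectors with coordinate sum zero the floor is exact, by
  \<open>half_sqnorm_Nats\<close>.\<close>

definition half_norm :: "nat \<Rightarrow> (nat \<Rightarrow>\<^sub>0 int) \<Rightarrow> nat" where
  "half_norm n \<gamma> = nat \<lfloor>sqnorm n (\<lambda>i. real_of_int (Poly_Mapping.lookup \<gamma> i)) / 2\<rfloor>"

text \<open>The summand of the theorem expressed by column sets alone; \<open>s\<close> stands for
  the size of the shape divided by \<open>n\<close>.\<close>

definition filling_term :: "nat \<Rightarrow> nat \<Rightarrow> nat set list \<Rightarrow> lpoly fps" where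
  "filling_term n s Cs = fps_const (xmon (weight n s Cs)) *
     fps_X ^ (half_norm n (weight n s Cs) + pair_sum dcol Cs)"

text \<open>\<open>sqnorm\<close> is the squared length of the projection orthogonal to (1, ...,
  1).\<close>

lemma sqnorm_shift:
  assumes "0 < n"
  shows "sqnorm n (\<lambda>i. c i - s) = sqnorm n c"
proof -
  have 1: "(\<Sum>i=1..n. (c i - s)\<^sup>2) = (\<Sum>i=1..n. (c i)\<^sup>2) - 2 * s * (\<Sum>i=1..n. c i) + real n * s\<^sup>2"
    by (simp add: power2_diff sum.distrib sum_subtractf sum_distrib_left algebra_simps)
  have 2: "(\<Sum>i=1..n. c i - s) = (\<Sum>i=1..n. c i) - real n * s"
    by (simp add: sum_subtractf)
  show ?thesis
    using assms unfolding sqnorm_def vsum_def 1 2 by (simp add: field_simps power2_eq_square)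
qed

context shape
begin

context
  fixes F s
  assumes F: "F \<in> CSF n \<mu>" and s: "vsum n \<mu> = n * s"
begin

lemma vsum_weight: "vsum n (Poly_Mapping.lookup (weight n s (col_sets \<mu> F))) = 0"
proof -
  have "vsum n (Poly_Mapping.lookup (weight n s (col_sets \<mu> F))) =
      int (\<Sum>i=1..n. occ i (col_sets \<mu> F)) - int n * int s"
    by (simp add: vsum_def lookup_weight sum_subtractf)
  also have "(\<Sum>i=1..n. occ i (col_sets \<mu> F)) = n * s" using sum_occ[OF F] s by simp
  finally show ?thesis by simp
qed

text \<open>Normalising the content does not change its norm, and a normalised content has
  coordinate sum zero; thus the exponent is a natural number.\<close>

lemma q_expo_weight:
  "q_expo n \<mu> F = real (half_norm n (weight n s (col_sets \<mu> F)) + pair_sum dcol (col_sets \<mu> F))"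
proof -
  let ?w = "Poly_Mapping.lookup (weight n s (col_sets \<mu> F))"
  have "sqnorm n (\<lambda>i. real_of_int (?w i)) = sqnorm n (\<lambda>i. real (occ i (col_sets \<mu> F)) - real s)"
    unfolding sqnorm_def vsum_def by (simp add: lookup_weight)
  also have "\<dots> = sqnorm n (\<lambda>i. real (occ i (col_sets \<mu> F)))" by (rule sqnorm_shift[OF n_pos])
  finally have eq: "sqnorm n (\<lambda>i. real (occ i (col_sets \<mu> F))) / 2 = sqnorm n (\<lambda>i. real_of_int (?w i)) / 2"
    by simp
  moreover obtain m :: nat where "sqnorm n (\<lambda>i. real_of_int (?w i)) / 2 = real m"
    using half_sqnorm_Nats[OF vsum_weight] by (auto elim: Nats_cases)
  ultimately show ?thesis by (simp add: q_expo_eq[OF F] half_norm_def)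
qed

lemma xbar_eq: "xbar n \<mu> F = xmon (weight n s (col_sets \<mu> F))"
proof -
  have div: "vsum n \<mu> div n = s" using s n_pos by simp
  have "(\<Sum>u\<in>dg \<mu>. Poly_Mapping.single (F u) (1 :: int)) +
      (\<Sum>i=1..n. Poly_Mapping.single i (- int s)) = weight n s (col_sets \<mu> F)"
  proof (rule poly_mapping_eqI)
    fix i
    have "(\<Sum>u\<in>dg \<mu>. of_bool (F u = i) :: int) = (\<Sum>c=1..\<mu> 1. \<Sum>r=1..height \<mu> c. of_bool (F (r, c) = i))"
      by (rule sum_dg)
    also have "\<dots> = (\<Sum>c=1..\<mu> 1. of_bool (i \<in> col_set \<mu> F c))"
    proof (rule sum.cong)
      fix c assume c: "c \<in> {1..\<mu> 1}"
      have inj: "inj_on (\<lambda>r. F (r, c)) {1..height \<mu> c}"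
        by (rule strict_mono_on_imp_inj_on[OF CSF_strict_mono[OF F]]) (use c in simp)
      have "(\<Sum>r=1..height \<mu> c. of_bool (F (r, c) = i) :: int) = (\<Sum>x\<in>col_set \<mu> F c. of_bool (x = i))"
        unfolding col_set_def by (subst sum.reindex[OF inj]) simp
      also have "\<dots> = of_bool (i \<in> col_set \<mu> F c)"
        using finite_column[OF F] by (simp add: of_bool_def)
      finally show "(\<Sum>r=1..height \<mu> c. of_bool (F (r, c) = i) :: int) = of_bool (i \<in> col_set \<mu> F c)" .
    qed simp
    also have "\<dots> = int (occ i (col_sets \<mu> F))"
      unfolding occ_columns[OF F] by (simp add: of_bool_def sum.If_cases Int_def)
    finally have 1: "(\<Sum>u\<in>dg \<mu>. of_bool (F u = i) :: int) = int (occ i (col_sets \<mu> F))" .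
    have 2: "occ i (col_sets \<mu> F) = 0" if "i \<notin> {1..n}"
    proof -
      have "{c \<in> {1..\<mu> 1}. i \<in> col_set \<mu> F c} = {}" using that column_subset[OF F] by fastforce
      thus ?thesis unfolding occ_columns[OF F] by (simp only: card.empty)
    qed
    show "Poly_Mapping.lookup ((\<Sum>u\<in>dg \<mu>. Poly_Mapping.single (F u) (1 :: int)) +
      (\<Sum>i=1..n. Poly_Mapping.single i (- int s))) i = Poly_Mapping.lookup (weight n s (col_sets \<mu> F)) i"
      using 1[unfolded eq_commute[of _ i]] 2 by (simp add: lookup_add lookup_sum lookup_single lookup_weight when_def of_bool_def)
  qed
  thus ?thesis by (simp add: xbar_def xvar_def xmon_sum div flip: xmon_add)
qed

lemma filling_term_eq:
  "fps_const (xbar n \<mu> F) * qpow (q_expo n \<mu> F) = filling_term n s (col_sets \<mu> F)"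
  by (simp add: xbar_eq q_expo_weight filling_term_def qpow_def del: of_nat_add)

end

end

section \<open>The limit of the partial sums\<close>

lemma chi_Lambda0_eq: "chi_Lambda0 n = Theta n * euler_inv ^ (n - 1)"
proof -
  have "euler_prod ^ (n - 1) * euler_inv ^ (n - 1) = 1"
    by (simp add: euler_prod_mult_inv flip: power_mult_distrib)
  hence "chi_Lambda0 n = chi_Lambda0 n * euler_prod ^ (n - 1) * euler_inv ^ (n - 1)"
    by (simp add: mult.assoc)
  thus ?thesis by (simp only: chi_mult_euler_prod)
qed

definition zero_vecs :: "nat \<Rightarrow> (nat \<Rightarrow>\<^sub>0 int) set" where
  "zero_vecs n = {\<gamma> \<in> int_vecs n. vsum n (Poly_Mapping.lookup \<gamma>) = 0}"

text \<open>The vectors whose theta terms are visible modulo \<open>q^(d+1)\<close>; there are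
  finitely many.\<close>

definition small_vecs :: "nat \<Rightarrow> nat \<Rightarrow> (nat \<Rightarrow>\<^sub>0 int) set" where
  "small_vecs n d = {\<gamma> \<in> zero_vecs n. half_norm n \<gamma> \<le> d}"

definition theta_term :: "nat \<Rightarrow> (nat \<Rightarrow>\<^sub>0 int) \<Rightarrow> lpoly fps" where
  "theta_term n \<gamma> = fps_const (xmon \<gamma>) * fps_X ^ half_norm n \<gamma>"

lemma xmon_nonzero: "xmon \<gamma> \<noteq> 0"
  by (simp add: xmon_def)

lemma theta_term_nth: "fps_nth (theta_term n \<gamma>) i = (if i = half_norm n \<gamma> then xmon \<gamma> else 0)"
  by (simp add: theta_term_def)

lemma Theta_has_sum: "(theta_term n has_sum Theta n) (zero_vecs n)"
proof -
  have "theta_term n = (\<lambda>\<gamma>. fps_const (xmon \<gamma>) *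
      qpow (sqnorm n (\<lambda>i. real_of_int (Poly_Mapping.lookup \<gamma> i)) / 2))"
    by (rule ext) (simp only: theta_term_def qpow_def half_norm_def)
  thus ?thesis
    unfolding Theta_def zero_vecs_def by (simp only: has_sum_infsum[OF Theta_summable])
qed

lemma finite_small_vecs: "finite (small_vecs n d)"
proof -
  have "small_vecs n d = (\<Union>i\<le>d. {\<gamma> \<in> zero_vecs n. fps_nth (theta_term n \<gamma>) i \<noteq> 0})"
    by (auto simp: small_vecs_def theta_term_nth xmon_nonzero)
  thus ?thesis using has_sum_fpsD(1)[OF Theta_has_sum] by simp
qed

lemma Theta_cong: "fps_cong d (Theta n) (\<Sum>\<gamma>\<in>small_vecs n d. theta_term n \<gamma>)"
  unfolding fps_cong_def
proof (intro allI impI)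
  fix i assume "i \<le> d"
  have "fps_nth (Theta n) i = (\<Sum>\<gamma> | \<gamma> \<in> zero_vecs n \<and> fps_nth (theta_term n \<gamma>) i \<noteq> 0. fps_nth (theta_term n \<gamma>) i)"
    by (rule has_sum_fpsD(2)[OF Theta_has_sum])
  also have "\<dots> = (\<Sum>\<gamma>\<in>small_vecs n d. fps_nth (theta_term n \<gamma>) i)"
    using \<open>i \<le> d\<close> finite_small_vecs
    by (intro sum.mono_neutral_left) (auto simp: small_vecs_def theta_term_nth split: if_splits)
  finally show "fps_nth (Theta n) i = fps_nth (\<Sum>\<gamma>\<in>small_vecs n d. theta_term n \<gamma>) i"
    by (simp add: fps_sum_nth)
qed

lemma weight_eq_iff:
  assumes "\<gamma> \<in> int_vecs n" "\<forall>i\<in>{1..n}. 0 \<le> Poly_Mapping.lookup \<gamma> i + int s"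
  shows "weight n s Cs = \<gamma> \<longleftrightarrow> (\<forall>i\<in>{1..n}. occ i Cs = nat (Poly_Mapping.lookup \<gamma> i + int s))"
proof -
  have "Poly_Mapping.lookup \<gamma> i = 0" if "i \<notin> {1..n}" for i
    using assms(1) that by (auto simp: int_vecs_def in_keys_iff subset_iff)
  hence "weight n s Cs = \<gamma> \<longleftrightarrow> (\<forall>i\<in>{1..n}. int (occ i Cs) - int s = Poly_Mapping.lookup \<gamma> i)"
    by (auto simp: poly_mapping_eq_iff fun_eq_iff lookup_weight)
  also have "\<dots> \<longleftrightarrow> (\<forall>i\<in>{1..n}. occ i Cs = nat (Poly_Mapping.lookup \<gamma> i + int s))"
    using assms(2) by (intro ball_cong refl) (fastforce simp: nat_eq_iff2)
  finally show ?thesis .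
qed

text \<open>Fillings are grouped by weight. Weights outside \<open>small_vecs n d\<close> give
  exponents above \<open>d\<close>; each of the others contributes its theta term times a generating
  function that is known modulo \<open>q^(d+1)\<close> by assumption.\<close>

lemma sum_filling_term_cong:
  assumes zero: "\<And>Cs. Cs \<in> fillings n \<eta> \<Longrightarrow> weight n s Cs \<in> zero_vecs n"
    and nonneg: "\<And>\<gamma> i. \<gamma> \<in> small_vecs n d \<Longrightarrow> i \<in> {1..n} \<Longrightarrow> 0 \<le> Poly_Mapping.lookup \<gamma> i + int s"
    and D: "\<And>\<gamma>. \<gamma> \<in> small_vecs n d \<Longrightarrow>
      fps_cong d (Dgen n \<eta> (\<lambda>i. nat (Poly_Mapping.lookup \<gamma> i + int s))) (euler_inv ^ (n - 1))"
  shows "fps_cong d (\<Sum>Cs\<in>fillings n \<eta>. filling_term n s Cs) (chi_Lambda0 n)"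
proof -
  let ?S = "{Cs \<in> fillings n \<eta>. weight n s Cs \<in> small_vecs n d}"
  have "fps_cong d (\<Sum>Cs\<in>fillings n \<eta>. filling_term n s Cs) (\<Sum>Cs\<in>?S. filling_term n s Cs)"
    unfolding fps_cong_def fps_sum_nth
  proof (intro allI impI sum.mono_neutral_right ballI finite_fillings)
    fix i Cs assume "i \<le> d" "Cs \<in> fillings n \<eta> - ?S"
    hence "d < half_norm n (weight n s Cs)" using zero by (auto simp: small_vecs_def)
    thus "fps_nth (filling_term n s Cs) i = 0"
      using \<open>i \<le> d\<close> by (simp add: filling_term_def)
  qed auto
  also have "(\<Sum>Cs\<in>?S. filling_term n s Cs) =
      (\<Sum>\<gamma>\<in>small_vecs n d. \<Sum>Cs | Cs \<in> ?S \<and> weight n s Cs = \<gamma>. filling_term n s Cs)"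
    by (rule sum.group[symmetric]) (auto simp: finite_fillings finite_small_vecs)
  also have "\<dots> = (\<Sum>\<gamma>\<in>small_vecs n d. theta_term n \<gamma> * Dgen n \<eta> (\<lambda>i. nat (Poly_Mapping.lookup \<gamma> i + int s)))"
  proof (rule sum.cong[OF refl])
    fix \<gamma> assume \<gamma>: "\<gamma> \<in> small_vecs n d"
    hence "\<gamma> \<in> int_vecs n" by (simp add: small_vecs_def zero_vecs_def)
    hence iff: "weight n s Cs = \<gamma> \<longleftrightarrow> (\<forall>i\<in>{1..n}. occ i Cs = nat (Poly_Mapping.lookup \<gamma> i + int s))" for Cs
      using nonneg[OF \<gamma>] by (intro weight_eq_iff) auto
    have "{Cs. Cs \<in> ?S \<and> weight n s Cs = \<gamma>} = {Cs \<in> fillings n \<eta>. weight n s Cs = \<gamma>}"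
      using \<gamma> by auto
    also have "\<dots> = with_content n \<eta> (\<lambda>i. nat (Poly_Mapping.lookup \<gamma> i + int s))"
      unfolding with_content_def iff ..
    finally have "{Cs. Cs \<in> ?S \<and> weight n s Cs = \<gamma>} =
      with_content n \<eta> (\<lambda>i. nat (Poly_Mapping.lookup \<gamma> i + int s))" .
    moreover have "filling_term n s Cs = theta_term n \<gamma> * fps_X ^ pair_sum dcol Cs" if "weight n s Cs = \<gamma>" for Cs
      using that by (simp add: filling_term_def theta_term_def power_add mult.assoc)
    ultimately show "(\<Sum>Cs | Cs \<in> ?S \<and> weight n s Cs = \<gamma>. filling_term n s Cs) =
        theta_term n \<gamma> * Dgen n \<eta> (\<lambda>i. nat (Poly_Mapping.lookup \<gamma> i + int s))"
      unfolding Dgen_def sum_distrib_left by (intro sum.cong) auto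
  qed
  also have "fps_cong d \<dots> (\<Sum>\<gamma>\<in>small_vecs n d. theta_term n \<gamma> * euler_inv ^ (n - 1))"
    by (intro fps_cong_sum fps_cong_mult fps_cong_refl D)
  also have "\<dots> = (\<Sum>\<gamma>\<in>small_vecs n d. theta_term n \<gamma>) * euler_inv ^ (n - 1)"
    by (simp add: sum_distrib_right)
  also have "fps_cong d \<dots> (chi_Lambda0 n)"
    unfolding chi_Lambda0_eq by (intro fps_cong_mult fps_cong_refl fps_cong_sym[OF Theta_cong])
  finally show ?thesis .
qed

section \<open>The chain of shapes lambda + k theta and the telescoping sum\<close>

locale hroot_chain =
  fixes n :: nat and lam :: "nat \<Rightarrow> nat"
  assumes n: "n \<ge> 2" and part: "is_partition lam" and parts: "num_parts lam < n" and dvd: "n dvd vsum n lam"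
begin

text \<open>A nonzero part with index \<open>i \<ge> n\<close> would make all parts from 1 to
  \<open>i\<close> nonzero, too many for \<open>num_parts\<close>.\<close>

lemma lam_zero: "lam i = 0" if "n \<le> i"
proof (rule ccontr)
  assume nz: "lam i \<noteq> 0"
  have mono: "lam i \<le> lam j" if "1 \<le> j" "j \<le> i" for j
    using that(2)
  proof (induction rule: inc_induct)
    case (step m)
    thus ?case using part that(1) le_trans[of "lam i" "lam (Suc m)" "lam m"] by (simp add: is_partition_def)
  qed simp
  have "{1..i} \<subseteq> {j. j \<ge> 1 \<and> lam j \<noteq> 0}" using mono nz by fastforce
  hence "card {1..i} \<le> num_parts lam"
    unfolding num_parts_def using part by (intro card_mono) (simp_all add: is_partition_def)
  thus False using parts that by simp
qed

lemma shape_add_hroot: "shape n (add_hroot n lam k)"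
proof
  show "0 < n" using n by simp
next
  fix i :: nat assume "1 \<le> i"
  hence "lam (Suc i) \<le> lam i" "hroot n (Suc i) \<le> hroot n i"
    using part by (auto simp: is_partition_def hroot_def)
  thus "add_hroot n lam k (Suc i) \<le> add_hroot n lam k i"
    by (simp add: add_hroot_def add_mono mult_le_mono2)
next
  fix i assume "n \<le> i"
  thus "add_hroot n lam k i = 0" using n lam_zero by (simp add: add_hroot_def hroot_def)
qed

definition size0 :: nat where
  "size0 = vsum n lam div n"

text \<open>The surplus of one over \<open>j\<close> pushes a fixed normalised content into the
  interior: the first \<open>j\<close> rows gain \<open>j * k + k\<close> cells while any
  \<open>j\<close> letters gain only \<open>j * k\<close> occurrences.\<close>

lemma sum_hroot: "1 \<le> j \<Longrightarrow> j < n \<Longrightarrow> (\<Sum>r=1..j. hroot n r) = Suc j"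
proof (induction j rule: nat_induct_at_least)
  case base
  show ?case by (simp add: hroot_def)
next
  case (Suc j)
  thus ?case by (simp add: hroot_def)
qed

lemma vsum_hroot: "vsum n (hroot n) = n"
proof -
  have "{1..n} = insert n {1..n - 1}" using n by auto
  hence "vsum n (hroot n) = hroot n n + (\<Sum>r=1..n - 1. hroot n r)"
    using n by (simp add: vsum_def)
  thus ?thesis using sum_hroot[of "n - 1"] n by (simp add: hroot_def)
qed

lemma vsum_add_hroot: "vsum n (add_hroot n lam k) = n * (size0 + k)"
proof -
  have "vsum n (add_hroot n lam k) = vsum n lam + k * vsum n (hroot n)"
    by (simp add: vsum_def add_hroot_def sum.distrib sum_distrib_left)
  thus ?thesis using dvd by (simp add: vsum_hroot size0_def algebra_simps)
qed

abbreviation "mu k \<equiv> add_hroot n lam k"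

lemma mu_Suc: "mu (Suc k) r = mu k r + hroot n r"
  by (simp add: add_hroot_def)

text \<open>Adding \<theta> lengthens the first row by two and the rows 2 to \<open>n - 1\<close> by
  one. This amounts to a new column of height \<open>n - 1\<close> in front, which shifts the old
  ones, and a single cell at the end of the first row.\<close>

lemma heights_Suc: "heights (mu (Suc k)) = (n - 1) # heights (mu k) @ [1]"
proof -
  interpret S: shape n "mu k" by (rule shape_add_hroot)
  define m where "m = mu k 1"
  have m': "mu (Suc k) 1 = Suc (Suc m)" by (simp add: m_def mu_Suc hroot_def)
  have first: "height (mu (Suc k)) 1 = n - 1"
  proof -
    have "{r. (r, 1) \<in> dg (mu (Suc k))} = {1..n - 1}"
      using n S.rows_zero by (auto simp: dg_def mu_Suc hroot_def not_less_eq_eq)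
    thus ?thesis by (simp add: height_def)
  qed
  have mid: "height (mu (Suc k)) (Suc c) = height (mu k) c" if c: "1 \<le> c" "c \<le> m" for c
  proof -
    have "(r, Suc c) \<in> dg (mu (Suc k)) \<longleftrightarrow> (r, c) \<in> dg (mu k)" for r
    proof (cases "r < n")
      case True
      thus ?thesis using c by (auto simp: dg_def mu_Suc hroot_def m_def)
    next
      case False
      hence "mu (Suc k) r = 0" "mu k r = 0"
        using shape.rows_zero[OF shape_add_hroot] by simp_all
      thus ?thesis using c by (simp add: dg_def)
    qed
    thus ?thesis by (simp add: height_def)
  qed
  have last: "height (mu (Suc k)) (Suc (Suc m)) = 1"
  proof -
    have "mu (Suc k) r < Suc (Suc m)" if "2 \<le> r" for r
      using S.rows_le[of 1 r] that by (simp add: mu_Suc hroot_def m_def)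
    hence "r = 1" if "(r, Suc (Suc m)) \<in> dg (mu (Suc k))" for r
      using that by (cases "2 \<le> r") (fastforce simp: dg_def)+
    moreover have "(1, Suc (Suc m)) \<in> dg (mu (Suc k))" using m' by (simp add: dg_def)
    ultimately have "{r. (r, Suc (Suc m)) \<in> dg (mu (Suc k))} = {1}" by blast
    thus ?thesis by (simp add: height_def)
  qed
  have "[1..<Suc (Suc (Suc m))] = 1 # map Suc [1..<Suc m] @ [Suc (Suc m)]"
    by (simp add: map_Suc_upt upt_conv_Cons del: upt_Suc) (simp add: upt_conv_Cons)
  moreover have "map (height (mu (Suc k))) (map Suc [1..<Suc m]) = map (height (mu k)) [1..<Suc m]"
    using mid by (auto simp: less_Suc_eq_le)
  ultimately show ?thesis
    unfolding heights_def m' m_def[symmetric] by (simp only: list.map map_append first last)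
qed

definition partial_sum :: "nat \<Rightarrow> lpoly fps" where
  "partial_sum k = (\<Sum>Cs\<in>fillings n (heights (mu k)). filling_term n (size0 + k) Cs)"

lemma partial_sum_CSF:
  "partial_sum k = (\<Sum>F\<in>CSF n (mu k). filling_term n (size0 + k) (col_sets (mu k) F))"
  unfolding partial_sum_def
  by (rule sum.reindex_bij_betw[symmetric, OF shape.bij_betw_col_sets[OF shape_add_hroot]])

definition wrap :: "nat set list \<Rightarrow> nat set list" where
  "wrap Cs = {2..n} # Cs @ [{1}]"

lemma inj_wrap: "inj wrap"
  by (auto simp: inj_def wrap_def)

text \<open>The letter 1 has rank 0 in every column, and it is the only letter that can be missing
  from \<open>{2..n}\<close> or be new in \<open>{1}\<close>.\<close>

lemma pair_sum_dcol_wrap: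
  assumes "\<forall>A\<in>set Cs. A \<subseteq> {1..n}"
  shows "pair_sum dcol (wrap Cs) = pair_sum dcol Cs"
proof -
  have below: "A \<inter> {..<1} = {}" if "A \<subseteq> {1..n}" for A using that by auto
  have left: "dcol {2..n} B = 0" if "B \<subseteq> {1..n}" for B
  proof -
    have "b = 1" if "b \<in> B - {2..n}" for b using that \<open>B \<subseteq> {1..n}\<close> by (cases "b = 1") fastforce+
    moreover have "{2..n} \<inter> {..<1} = {}" by auto
    ultimately have "{b \<in> B - {2..n}. card ({2..n} \<inter> {..<b}) \<noteq> card (B \<inter> {..<b})} = {}"
      using below[OF that] by fastforce
    thus ?thesis unfolding dcol_def by (simp only: card.empty)
  qed
  have right: "dcol A {1} = 0" if "A \<subseteq> {1..n}" for A
    using below[OF that] by (auto simp: dcol_def)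
  have "(\<Sum>B\<leftarrow>Cs @ [{1}]. dcol {2..n} B) = 0" "(\<Sum>A\<leftarrow>Cs. dcol A {1}) = 0"
    using assms left right n by simp_all
  thus ?thesis unfolding wrap_def pair_sum.simps pair_sum_append by simp
qed

text \<open>The two added columns contain every letter once between them, matching the step from
  \<open>s\<close> to \<open>Suc s\<close>.\<close>

lemma filling_term_wrap:
  assumes "Cs \<in> fillings n \<eta>"
  shows "filling_term n (Suc s) (wrap Cs) = filling_term n s Cs"
proof -
  have "occ i (wrap Cs) = Suc (occ i Cs)" if "i \<in> {1..n}" for i
    using that by (auto simp: wrap_def occ_def)
  hence "weight n (Suc s) (wrap Cs) = weight n s Cs"
    unfolding weight_def by (intro sum.cong) auto
  thus ?thesis using assms by (simp add: filling_term_def pair_sum_dcol_wrap fillings_def)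
qed

text \<open>A set of \<open>n - 1\<close> letters without 1 is \<open>{2..n}\<close>, and a
  one-element set with 1 is \<open>{1}\<close>. The image consists of exactly the fillings that the
  definition of \<open>C_set\<close> excludes.\<close>

lemma wrap_image:
  "wrap ` fillings n (heights (mu k)) =
     {Cs \<in> fillings n (heights (mu (Suc k))). 1 \<notin> hd Cs \<and> 1 \<in> last Cs}"
proof (intro subset_antisym subsetI)
  fix Cs assume "Cs \<in> wrap ` fillings n (heights (mu k))"
  then obtain Bs where Bs: "Cs = wrap Bs" "map card Bs = heights (mu k)" "\<forall>B\<in>set Bs. B \<subseteq> {1..n}"
    by (auto simp only: fillings_def image_iff mem_Collect_eq)
  moreover have "{2..n} \<subseteq> {1..n}" "{1} \<subseteq> {1..n}" using n by auto
  ultimately show "Cs \<in> {Cs \<in> fillings n (heights (mu (Suc k))). 1 \<notin> hd Cs \<and> 1 \<in> last Cs}"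
    by (simp add: fillings_def heights_Suc wrap_def ball_Un del: One_nat_def atLeastatMost_subset_iff)
next
  fix Cs assume Cs: "Cs \<in> {Cs \<in> fillings n (heights (mu (Suc k))). 1 \<notin> hd Cs \<and> 1 \<in> last Cs}"
  hence "map card Cs = (n - 1) # heights (mu k) @ [1]"
    by (simp add: fillings_def heights_Suc)
  hence len: "map card Cs = ((n - 1) # heights (mu k)) @ [1]" by simp
  obtain Ds C where 1: "Cs = Ds @ [C]"
    using len by (cases Cs rule: rev_cases) simp_all
  obtain A Bs where 2: "Ds = A # Bs"
    using len 1 by (cases Ds) simp_all
  have split: "Cs = A # Bs @ [C]" "card A = n - 1" "map card Bs = heights (mu k)" "card C = 1"
    using len by (simp_all add: 1 2)
  have sub: "A \<subseteq> {1..n}" "\<forall>B\<in>set Bs. B \<subseteq> {1..n}" and mem: "1 \<notin> A" "1 \<in> C"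
    using Cs by (auto simp: split fillings_def)
  have "A \<subseteq> {2..n}"
  proof
    fix i assume "i \<in> A"
    thus "i \<in> {2..n}" using sub(1) mem(1) by (cases "i = 1") fastforce+
  qed
  hence "A = {2..n}" using split(2) by (intro card_subset_eq) auto
  moreover have "C = {1}" using split(4) mem(2) by (auto simp: card_1_singleton_iff)
  ultimately have "Cs = wrap Bs" by (simp add: split(1) wrap_def)
  moreover have "Bs \<in> fillings n (heights (mu k))" using sub(2) split(3) by (simp add: fillings_def)
  ultimately show "Cs \<in> wrap ` fillings n (heights (mu k))" by blast
qed

lemma C_set_subset: "C_set n lam k \<subseteq> CSF n (mu k)"
  by (auto simp: C_set_def add_hroot_def)

lemma q_expo_C_set:
  assumes "F \<in> C_set n lam k"
  shows "q_expo n (mu k) F \<in> \<nat>"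
    and "fps_const (xbar n (mu k) F) * qpow (q_expo n (mu k) F) =
      filling_term n (size0 + k) (col_sets (mu k) F)"
proof -
  interpret S: shape n "mu k" by (rule shape_add_hroot)
  have F: "F \<in> CSF n (mu k)" using assms C_set_subset by blast
  show "q_expo n (mu k) F \<in> \<nat>"
    unfolding S.q_expo_weight[OF F vsum_add_hroot] by (rule of_nat_in_Nats)
  show "fps_const (xbar n (mu k) F) * qpow (q_expo n (mu k) F) =
      filling_term n (size0 + k) (col_sets (mu k) F)"
    by (rule S.filling_term_eq[OF F vsum_add_hroot])
qed

definition layer :: "nat \<Rightarrow> lpoly fps" where
  "layer k = (\<Sum>F\<in>C_set n lam k. fps_const (xbar n (mu k) F) * qpow (q_expo n (mu k) F))"

lemma layer_0: "layer 0 = partial_sum 0"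
proof -
  have "mu 0 = lam" by (simp add: add_hroot_def)
  thus ?thesis
    unfolding layer_def partial_sum_CSF by (intro sum.cong q_expo_C_set(2)) (auto simp: C_set_def)
qed

text \<open>The fillings left out of \<open>C_set\<close> are the wrapped fillings of the previous
  shape, and wrapping preserves each term.\<close>

lemma layer_Suc: "layer (Suc k) + partial_sum k = partial_sum (Suc k)"
proof -
  interpret S: shape n "mu (Suc k)" by (rule shape_add_hroot)
  let ?f = "col_sets (mu (Suc k))" and ?g = "filling_term n (size0 + Suc k)"
  let ?Fil = "fillings n (heights (mu (Suc k)))"
  let ?B = "{Cs \<in> ?Fil. 1 \<notin> hd Cs \<and> 1 \<in> last Cs}"
  have m: "1 \<le> mu (Suc k) 1" by (simp add: mu_Suc hroot_def)
  have ends: "hd (?f F) = col_set (mu (Suc k)) F 1" "last (?f F) = col_set (mu (Suc k)) F (mu (Suc k) 1)" for F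
    using m by (simp_all add: col_sets_def hd_map last_map del: upt_Suc)
  have "C_set n lam (Suc k) = {F \<in> CSF n (mu (Suc k)). ?f F \<notin> ?B}"
    using S.columns_in_fillings m by (auto simp: C_set_def S.occurs_in_column_iff ends)
  moreover have bij: "bij_betw ?f (CSF n (mu (Suc k))) ?Fil" by (rule S.bij_betw_col_sets)
  ultimately have "bij_betw ?f (C_set n lam (Suc k)) (?Fil - ?B)"
    by (auto simp: bij_betw_def inj_on_def)
  hence reindex: "(\<Sum>F\<in>C_set n lam (Suc k). ?g (?f F)) = (\<Sum>Cs\<in>?Fil - ?B. ?g Cs)"
    by (rule sum.reindex_bij_betw)
  have layer: "layer (Suc k) = (\<Sum>F\<in>C_set n lam (Suc k). ?g (?f F))"
    unfolding layer_def by (rule sum.cong[OF refl q_expo_C_set(2)])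
  have diff: "(\<Sum>Cs\<in>?Fil - ?B. ?g Cs) + (\<Sum>Cs\<in>?B. ?g Cs) = partial_sum (Suc k)"
    unfolding partial_sum_def
  proof (rule sum.subset_diff[symmetric])
    show "?B \<subseteq> ?Fil" by (rule Collect_restrict)
  qed (rule finite_fillings)
  have "(\<Sum>Cs\<in>?B. ?g Cs) = (\<Sum>Cs\<in>fillings n (heights (mu k)). ?g (wrap Cs))"
    unfolding wrap_image[symmetric] using inj_on_subset[OF inj_wrap subset_UNIV]
    by (subst sum.reindex) (simp_all only: o_def)
  also have "\<dots> = partial_sum k"
    unfolding partial_sum_def add_Suc_right by (rule sum.cong[OF refl filling_term_wrap])
  finally show ?thesis unfolding layer reindex diff[symmetric] by (rule arg_cong[symmetric])
qed

text \<open>For fixed \<open>d\<close> only finitely many normalised contents matter, so a single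
  threshold for \<open>k\<close> puts all of them deep enough inside the permutohedron for
  \<open>Dgen_interior\<close>.\<close>

lemma partial_sum_cong: "\<exists>K. \<forall>k\<ge>K. fps_cong d (partial_sum k) (chi_Lambda0 n)"
proof -
  \<comment> \<open>\<open>B\<close> bounds the sum of the absolute coordinates of every small
    vector at once; \<open>M\<close> is the least slack that \<open>Dgen_interior\<close> accepts at
    precision \<open>d\<close>.\<close>
  define B where "B = (\<Sum>\<gamma>\<in>small_vecs n d. \<Sum>i=1..n. nat \<bar>Poly_Mapping.lookup \<gamma> i\<bar>)"
  define M where "M = Suc (n * d)"
  have "fps_cong d (partial_sum k) (chi_Lambda0 n)" if k: "B + n * size0 + M \<le> k" for k
    unfolding partial_sum_def
  proof (rule sum_filling_term_cong)
    interpret S: shape n "mu k" by (rule shape_add_hroot)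
    let ?s = "size0 + k"
    fix Cs assume "Cs \<in> fillings n (heights (mu k))"
    then obtain F where F: "F \<in> CSF n (mu k)" "Cs = col_sets (mu k) F"
      using S.bij_betw_col_sets by (metis bij_betw_imp_surj_on imageE)
    have "weight n ?s Cs \<in> int_vecs n"
      by (auto simp: int_vecs_def in_keys_iff lookup_weight split: if_splits)
    thus "weight n ?s Cs \<in> zero_vecs n"
      using S.vsum_weight[OF F(1) vsum_add_hroot] F(2) by (simp add: zero_vecs_def)
  next
    have abs_le: "(\<Sum>i=1..n. nat \<bar>Poly_Mapping.lookup \<gamma> i\<bar>) \<le> B" if "\<gamma> \<in> small_vecs n d" for \<gamma>
      unfolding B_def by (rule member_le_sum) (use that finite_small_vecs in auto)
    have lookup_ge: "- int B \<le> Poly_Mapping.lookup \<gamma> i" if "\<gamma> \<in> small_vecs n d" "i \<in> {1..n}" for \<gamma> i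
    proof -
      have "nat \<bar>Poly_Mapping.lookup \<gamma> i\<bar> \<le> (\<Sum>i=1..n. nat \<bar>Poly_Mapping.lookup \<gamma> i\<bar>)"
        by (rule member_le_sum) (use that in auto)
      thus ?thesis using abs_le[OF that(1)] by linarith
    qed
    show nonneg: "0 \<le> Poly_Mapping.lookup \<gamma> i + int (size0 + k)" if "\<gamma> \<in> small_vecs n d" "i \<in> {1..n}" for \<gamma> i
      using lookup_ge[OF that] k by linarith
    interpret S: shape n "mu k" by (rule shape_add_hroot)
    fix \<gamma> assume \<gamma>: "\<gamma> \<in> small_vecs n d"
    define g where "g i = nat (Poly_Mapping.lookup \<gamma> i + int (size0 + k))" for i
    have g: "int (g i) = Poly_Mapping.lookup \<gamma> i + int (size0 + k)" if "i \<in> {1..n}" for i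
      using nonneg[OF \<gamma> that] by (simp add: g_def)
    have sum_g: "int (sum g I) = (\<Sum>i\<in>I. Poly_Mapping.lookup \<gamma> i) + int (card I) * int (size0 + k)"
      if "I \<subseteq> {1..n}" for I
    proof -
      have "int (sum g I) = (\<Sum>i\<in>I. Poly_Mapping.lookup \<gamma> i + int (size0 + k))"
        unfolding of_nat_sum by (rule sum.cong) (use that g in auto)
      thus ?thesis by (simp add: sum.distrib)
    qed
    show "fps_cong d (Dgen n (heights (mu k)) (\<lambda>i. nat (Poly_Mapping.lookup \<gamma> i + int (size0 + k)))) (euler_inv ^ (n - 1))"
      unfolding g_def[symmetric]
    proof (rule Dgen_interior[where M = M])
      show "1 \<le> n" using n by simp
      show "sorted_wrt (\<lambda>a b. b \<le> Suc a) (heights (mu k))"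
        unfolding heights_def sorted_wrt_map
        by (rule sorted_wrt_mono_rel[OF _ sorted_wrt_upt]) (use S.height_antimono in \<open>auto intro!: le_SucI\<close>)
      show "\<forall>h\<in>set (heights (mu k)). h \<le> n"
        using S.height_less_n by (auto simp: heights_def intro!: less_imp_le)
      have "int (sum g {1..n}) = int n * int (size0 + k)"
        using \<gamma> sum_g[of "{1..n}"] by (simp add: small_vecs_def zero_vecs_def vsum_def)
      hence "sum g {1..n} = n * (size0 + k)" by (metis of_nat_eq_iff of_nat_mult)
      moreover have "sum_list (heights (mu k)) = vsum n (mu k)"
        unfolding S.sum_heights[symmetric] heights_def
        by (simp only: interv_sum_list_conv_sum_set_nat set_upt atLeastLessThanSuc_atLeastAtMost)
      ultimately show "sum_list (heights (mu k)) = sum g {1..n}" by (simp add: vsum_add_hroot)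
      show "n * d < M" by (simp add: M_def)
      show "slack n M (heights (mu k)) g"
        unfolding slack_def
      proof (intro allI impI, elim conjE)
        fix I assume I: "I \<subseteq> {1..n}" "I \<noteq> {}" "I \<noteq> {1..n}"
        hence fin: "finite I" using finite_subset by blast
        define j where "j = card I"
        have "0 < j" using I fin by (simp add: j_def card_gt_0_iff)
        moreover have "j < n" using psubset_card_mono[of "{1..n}" I] I by (auto simp: j_def)
        ultimately have j: "1 \<le> j" "j < n" by simp_all
        have "(\<Sum>i\<in>I. Poly_Mapping.lookup \<gamma> i) \<le> (\<Sum>i\<in>I. int (nat \<bar>Poly_Mapping.lookup \<gamma> i\<bar>))"
          by (rule sum_mono) simp
        also have "\<dots> \<le> (\<Sum>i=1..n. int (nat \<bar>Poly_Mapping.lookup \<gamma> i\<bar>))"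
          by (rule sum_mono2) (use I in auto)
        also have "\<dots> \<le> int B" using abs_le[OF \<gamma>] by (metis of_nat_sum of_nat_mono)
        finally have 1: "int (sum g I) \<le> int B + int j * int (size0 + k)"
          using sum_g[OF I(1)] by (simp add: j_def)
        have "j * size0 \<le> n * size0" using j by (intro mult_le_mono1) simp
        moreover have "sum g I \<le> B + (j * size0 + j * k)"
          using 1 by (simp add: distrib_left del: of_nat_sum flip: of_nat_add of_nat_mult)
        \<comment> \<open>The surplus \<open>k\<close> absorbs the deviation \<open>B\<close>, the
          term \<open>j * size0\<close> and the required slack.\<close>
        ultimately have 2: "sum g I + M \<le> j * k + k" using k by linarith
        have "j * k + k \<le> (\<Sum>r=1..j. mu k r)"
        proof -
          have "(\<Sum>r=1..j. mu k r) = (\<Sum>r=1..j. lam r) + k * (\<Sum>r=1..j. hroot n r)"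
            by (simp add: add_hroot_def sum.distrib sum_distrib_left)
          thus ?thesis using sum_hroot[OF j] by (simp add: algebra_simps)
        qed
        thus "sum g I + M \<le> (\<Sum>h\<leftarrow>heights (mu k). min h (card I))"
          using 2 unfolding S.sum_min_heights j_def by linarith
      qed
    qed
  qed
  thus ?thesis by blast
qed

lemma sum_layers: "(\<Sum>k\<le>K. layer k) = partial_sum K"
  by (induction K) (simp_all add: layer_0 add.commute flip: layer_Suc)

text \<open>In each degree the partial sums become constant, so by \<open>layer_Suc\<close> all but
  finitely many layers vanish there and the finite sum telescopes.\<close>

lemma layers_has_sum: "(layer has_sum chi_Lambda0 n) UNIV"
proof (rule has_sum_fpsI)
  fix d
  obtain K where K: "\<forall>k\<ge>K. fps_nth (partial_sum k) d = fps_nth (chi_Lambda0 n) d"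
    using partial_sum_cong[of d] unfolding fps_cong_def by blast
  have "fps_nth (layer (Suc k)) d = 0" if "K \<le> k" for k
  proof -
    have "fps_nth (layer (Suc k)) d + fps_nth (partial_sum k) d = fps_nth (partial_sum (Suc k)) d"
      by (simp flip: layer_Suc)
    thus ?thesis using K that by simp
  qed
  hence sub: "{k \<in> UNIV. fps_nth (layer k) d \<noteq> 0} \<subseteq> {..K}"
    by (auto simp: not_le[symmetric]) (metis Suc_le_D Suc_le_mono not_less_eq_eq)
  thus "finite {k \<in> UNIV. fps_nth (layer k) d \<noteq> 0}" by (rule finite_subset) simp
  have "(\<Sum>k | k \<in> UNIV \<and> fps_nth (layer k) d \<noteq> 0. fps_nth (layer k) d) = (\<Sum>k\<le>K. fps_nth (layer k) d)"
    using sub by (intro sum.mono_neutral_left) auto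
  also have "\<dots> = fps_nth (chi_Lambda0 n) d"
    using K by (simp add: sum_layers flip: fps_sum_nth)
  finally show "fps_nth (chi_Lambda0 n) d = (\<Sum>k | k \<in> UNIV \<and> fps_nth (layer k) d \<noteq> 0. fps_nth (layer k) d)" ..
qed

end

theorem proposition10:
  fixes n :: nat and lam :: "nat \<Rightarrow> nat"
  assumes "n \<ge> 2"
    and "is_partition lam"
    and "num_parts lam < n"
    and "n dvd vsum n lam"
  shows "(\<forall>k. \<forall>F\<in>C_set n lam k. q_expo n (add_hroot n lam k) F \<in> \<nat>) \<and>
    ((\<lambda>k. \<Sum>F\<in>C_set n lam k.
        fps_const (xbar n (add_hroot n lam k) F) * qpow (q_expo n (add_hroot n lam k) F))
      has_sum chi_Lambda0 n) UNIV"
proof -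
  interpret hroot_chain n lam
    using assms by unfold_locales
  show ?thesis
    using layers_has_sum q_expo_C_set(1) unfolding layer_def by blast
qed

end
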